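(* The maximum likelihood degree of a regular net of conics $\mathcal{L}\subset\mathbb{S}^3$ depends only on its type. The ML-degree is: $4$ for type $A$; $3$ for types $B$ and $B^*$; $2$ for types $C$, $D$ and $D^*$; $1$ for types $E$, $E^*$ and $F^*$; and $0$ for types $F$, $G$, $G^*$ and $H$.
   Context: Everything is over $\mathbb{C}$. $\mathbb{S}^3$ is the $6$-dimensional space of complex symmetric $3\times 3$ matrices. A net of conics is a $3$-dimensional linear subspace of $\mathbb{S}^3$; it is regular if it contains an invertible matrix. The maximum likelihood degree (ML-degree) of a linear space $\mathcal{L}\subset\mathbb{S}^n$ is the number of complex critical points of the log-likelihood function $\ell_S:\mathcal{L}\to\mathbb{R}$, $M\mapsto \log\det(M)-\mathrm{trace}(SM)$, for a generic matrix $S\in\mathbb{S}^n$. Since the critical equations are algebraic, this makes sense for complex linear spaces: it is the number of invertible $M\in\mathcal{L}$ with $\mathrm{trace}(M^{-1}N)=\mathrm{trace}(SN)$ for all $N\in\mathcal{L}$, for generic $S$. A symmetric matrix $M$ is identified with the quadratic form $(x,y,z)M(x,y,z)^T$; e.g. $2xz$ is the matrix with entries $1$ at positions $(1,3),(3,1)$ and $0$ elsewhere. Two nets $\mathcal{L}_1,\mathcal{L}_2$ are congruent if $\mathcal{L}_2=g^T\mathcal{L}_1 g$ for some $g\in \mathrm{GL}(3,\mathbb{C})$. Types (Wall's classification; every regular net is of exactly one of these types): a net is of a given type if it is congruent to a net spanned by the following generators. $A$: $y^2+2xz,\ 2yz,\ -x^2-2gy^2+cz^2+2gxz$ for some constants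 $c,g\in\mathbb{C}$ with $c\neq 0$, $c\neq -9g^2$. $B$: $y^2+2xz,\ 2yz,\ -x^2-2y^2-9z^2+2xz$. $B^*$: $y^2+2xz,\ 2yz,\ -x^2-2y^2+2xz$. $C$: $y^2+2xz,\ 2yz,\ -x^2$. $D$: $x^2,\ y^2,\ z^2+2xy$. $D^*$: $2xz,\ 2yz,\ z^2+2xy$. $E$: $x^2,\ y^2,\ z^2$. $E^*$: $2xz,\ 2yz,\ 2xy$. $F$: $x^2,\ y^2,\ 2xz+2yz$. $F^*$: $x^2,\ 2xy,\ y^2+z^2$. $G$: $x^2,\ y^2,\ 2yz$. $G^*$: $x^2,\ 2xy,\ 2yz$. $H$: $x^2,\ 2xy,\ y^2+2xz$. *)

theory Defs
  imports "HOL-Analysis.Analysis"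
begin

section \<open>Complex spaces of symmetric matrices\<close>

text \<open>
  The scalar multiplication \<open>*s\<close> of the library acts on matrices through row vectors as scalars, and
  \<open>*\<^sub>R\<close> only gives the real structure; linear spaces of matrices have to be taken over the
  complex numbers here.
\<close>

definition cscale :: "complex \<Rightarrow> complex^'n^'m \<Rightarrow> complex^'n^'m" where
  "cscale c M = (\<chi> i j. c * M $ i $ j)"

global_interpretation cmat: vector_space "cscale :: complex \<Rightarrow> complex^'n^'m \<Rightarrow> complex^'n^'m"
  defines csubspace = cmat.subspace
    and cspan = cmat.span
    and cdim = cmat.dim
  by unfold_locales (simp_all add: cscale_def vec_eq_iff algebra_simps)

definition sym_mats :: "(complex^'n^'n) set" where
  "sym_mats = {M. transpose M = M}"


section \<open>Genericity and the maximum likelihood degree\<close>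

inductive poly_fun :: "(complex^'n^'m \<Rightarrow> complex) \<Rightarrow> bool" where
  const: "poly_fun (\<lambda>S. c)"
| entry: "poly_fun (\<lambda>S. S $ i $ j)"
| add: "poly_fun p \<Longrightarrow> poly_fun q \<Longrightarrow> poly_fun (\<lambda>S. p S + q S)"
| mult: "poly_fun p \<Longrightarrow> poly_fun q \<Longrightarrow> poly_fun (\<lambda>S. p S * q S)"

text \<open>
  A property holds for generic symmetric \<open>S\<close> if it holds on a nonempty Zariski open subset of
  the space of symmetric matrices, equivalently on some nonempty principal open set.
\<close>

definition for_generic_sym :: "(complex^'n^'n \<Rightarrow> bool) \<Rightarrow> bool" where
  "for_generic_sym P \<longleftrightarrow>
     (\<exists>p. poly_fun p \<and> (\<exists>S\<in>sym_mats. p S \<noteq> 0) \<and> (\<forall>S\<in>sym_mats. p S \<noteq> 0 \<longrightarrow> P S))"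

text \<open>
  Critical points on \<open>L\<close> of \<open>M \<mapsto> log det M - trace (S M)\<close>: the
  derivative of \<open>log det\<close> at \<open>M\<close> in direction \<open>N\<close> is \<open>trace (M\<^sup>-\<^sup>1 N)\<close>, independently of
  the branch of the logarithm.
\<close>

definition critical_points :: "(complex^'n^'n) set \<Rightarrow> complex^'n^'n \<Rightarrow> (complex^'n^'n) set" where
  "critical_points L S =
     {M \<in> L. invertible M \<and> (\<forall>N\<in>L. trace (matrix_inv M ** N) = trace (S ** N))}"

text \<open>
  Finiteness is required explicitly because \<open>card\<close> is \<open>0\<close> on infinite sets. The number \<open>d\<close> is
  determined by \<open>L\<close>; see \<open>has_ml_degree_unique\<close> below.
\<close>

definition has_ml_degree :: "(complex^'n^'n) set \<Rightarrow> nat \<Rightarrow> bool" where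
  "has_ml_degree L d \<longleftrightarrow>
     for_generic_sym (\<lambda>S. finite (critical_points L S) \<and> card (critical_points L S) = d)"

lemma poly_fun_on_line:
  assumes "poly_fun p"
  shows "\<exists>q. \<forall>t. p (S + cscale t T) = poly q t"
  using assms
proof induction
  case (const c)
  show ?case by (rule exI[of _ "[:c:]"]) simp
next
  case (entry i j)
  show ?case by (rule exI[of _ "[:S $ i $ j, T $ i $ j:]"]) (simp add: cscale_def)
next
  case (add p q)
  then show ?case by (metis poly_add)
next
  case (mult p q)
  then show ?case by (metis poly_mult)
qed

lemma for_generic_sym_both:
  assumes "for_generic_sym P" "for_generic_sym Q"
  shows "\<exists>S\<in>sym_mats. P S \<and> Q S"
proof -
  obtain p S0 where p: "poly_fun p" "S0 \<in> sym_mats" "p S0 \<noteq> 0"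
      "\<And>S. S \<in> sym_mats \<Longrightarrow> p S \<noteq> 0 \<Longrightarrow> P S"
    using assms(1) unfolding for_generic_sym_def by blast
  obtain q S1 where q: "poly_fun q" "S1 \<in> sym_mats" "q S1 \<noteq> 0"
      "\<And>S. S \<in> sym_mats \<Longrightarrow> q S \<noteq> 0 \<Longrightarrow> Q S"
    using assms(2) unfolding for_generic_sym_def by blast
  let ?l = "\<lambda>t. S0 + cscale t (S1 - S0)"
  obtain u where u: "\<And>t. p (?l t) = poly u t" using poly_fun_on_line[OF p(1)] by metis
  obtain v where v: "\<And>t. q (?l t) = poly v t" using poly_fun_on_line[OF q(1)] by metis
  have l: "?l 0 = S0" "?l 1 = S1" by (simp_all add: cscale_def vec_eq_iff)
  have "u \<noteq> 0" using u[of 0] p(3) l(1) by auto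
  moreover have "v \<noteq> 0" using v[of 1] q(3) l(2) by auto
  ultimately have "finite {t. poly (u * v) t = 0}" by (intro poly_roots_finite) simp
  then obtain t where "poly (u * v) t \<noteq> 0"
    using ex_new_if_finite[OF infinite_UNIV_char_0] by blast
  then have "p (?l t) \<noteq> 0" "q (?l t) \<noteq> 0" by (auto simp: u v)
  moreover have "?l t \<in> sym_mats"
    using p(2) q(2) by (auto simp: sym_mats_def transpose_def cscale_def vec_eq_iff)
  ultimately show ?thesis using p(4) q(4) by blast
qed

lemma has_ml_degree_unique:
  assumes "has_ml_degree L d" "has_ml_degree L e"
  shows "d = e"
  using for_generic_sym_both[OF assms[unfolded has_ml_degree_def]] by auto


section \<open>Nets of conics and their types\<close>

definition net_of_conics :: "(complex^3^3) set \<Rightarrow> bool" where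
  "net_of_conics L \<longleftrightarrow> L \<subseteq> sym_mats \<and> csubspace L \<and> cdim L = 3"

definition regular_net :: "(complex^3^3) set \<Rightarrow> bool" where
  "regular_net L \<longleftrightarrow> net_of_conics L \<and> (\<exists>M\<in>L. invertible M)"

definition congruent_nets :: "(complex^3^3) set \<Rightarrow> (complex^3^3) set \<Rightarrow> bool" where
  "congruent_nets L1 L2 \<longleftrightarrow>
     (\<exists>g :: complex^3^3. invertible g \<and> L2 = (\<lambda>M. transpose g ** M ** g) ` L1)"

text \<open>
  The symmetric matrix of a ternary quadratic form, by polarization: its \<open>(i, j)\<close> entry is
  \<open>(q (e\<^sub>i + e\<^sub>j) - q e\<^sub>i - q e\<^sub>j) / 2\<close>. For instance \<open>2 * x * z\<close> has entries \<open>1\<close> at \<open>(1, 3)\<close>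
  and \<open>(3, 1)\<close>.
\<close>

definition form_mat :: "(complex \<Rightarrow> complex \<Rightarrow> complex \<Rightarrow> complex) \<Rightarrow> complex^3^3" where
  "form_mat q =
     (let Q = (\<lambda>v :: complex^3. q (v $ 1) (v $ 2) (v $ 3))
      in \<chi> i j. (Q (axis i 1 + axis j 1) - Q (axis i 1) - Q (axis j 1)) / 2)"

lemma form_mat_eqI:
  assumes "M \<in> sym_mats"
    and "\<And>x y z. q x y z =
      (\<Sum>i\<in>UNIV. \<Sum>j\<in>UNIV. vector [x, y, z] $ i * M $ i $ j * (vector [x, y, z] :: complex^3) $ j)"
  shows "form_mat q = M"
proof -
  have "M $ j $ i = M $ i $ j" for i j
    using assms(1) by (auto simp: sym_mats_def transpose_def vec_eq_iff)
  from this[of 1 2] this[of 1 3] this[of 2 3] show ?thesis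
    by (simp add: form_mat_def assms(2) sum_3 vec_eq_iff forall_3 axis_def algebra_simps)
qed

datatype net_type =
  Type_A | Type_B | Type_Bstar | Type_C | Type_D | Type_Dstar | Type_E | Type_Estar
| Type_F | Type_Fstar | Type_G | Type_Gstar | Type_H

definition net_spanned_by ::
  "(complex \<Rightarrow> complex \<Rightarrow> complex \<Rightarrow> complex) \<Rightarrow> (complex \<Rightarrow> complex \<Rightarrow> complex \<Rightarrow> complex) \<Rightarrow>
   (complex \<Rightarrow> complex \<Rightarrow> complex \<Rightarrow> complex) \<Rightarrow> (complex^3^3) set" where
  "net_spanned_by q1 q2 q3 = cspan {form_mat q1, form_mat q2, form_mat q3}"

fun normal_form :: "net_type \<Rightarrow> (complex^3^3) set \<Rightarrow> bool" where
  "normal_form Type_A N \<longleftrightarrow> (\<exists>c g. c \<noteq> 0 \<and> c \<noteq> - (9 * g^2) \<and>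
     N = net_spanned_by (\<lambda>x y z. y^2 + 2*x*z) (\<lambda>x y z. 2*y*z)
           (\<lambda>x y z. -(x^2) - 2*g*y^2 + c*z^2 + 2*g*x*z))"
| "normal_form Type_B N \<longleftrightarrow>
     N = net_spanned_by (\<lambda>x y z. y^2 + 2*x*z) (\<lambda>x y z. 2*y*z)
           (\<lambda>x y z. -(x^2) - 2*y^2 - 9*z^2 + 2*x*z)"
| "normal_form Type_Bstar N \<longleftrightarrow>
     N = net_spanned_by (\<lambda>x y z. y^2 + 2*x*z) (\<lambda>x y z. 2*y*z)
           (\<lambda>x y z. -(x^2) - 2*y^2 + 2*x*z)"
| "normal_form Type_C N \<longleftrightarrow>
     N = net_spanned_by (\<lambda>x y z. y^2 + 2*x*z) (\<lambda>x y z. 2*y*z) (\<lambda>x y z. -(x^2))"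
| "normal_form Type_D N \<longleftrightarrow>
     N = net_spanned_by (\<lambda>x y z. x^2) (\<lambda>x y z. y^2) (\<lambda>x y z. z^2 + 2*x*y)"
| "normal_form Type_Dstar N \<longleftrightarrow>
     N = net_spanned_by (\<lambda>x y z. 2*x*z) (\<lambda>x y z. 2*y*z) (\<lambda>x y z. z^2 + 2*x*y)"
| "normal_form Type_E N \<longleftrightarrow>
     N = net_spanned_by (\<lambda>x y z. x^2) (\<lambda>x y z. y^2) (\<lambda>x y z. z^2)"
| "normal_form Type_Estar N \<longleftrightarrow>
     N = net_spanned_by (\<lambda>x y z. 2*x*z) (\<lambda>x y z. 2*y*z) (\<lambda>x y z. 2*x*y)"
| "normal_form Type_F N \<longleftrightarrow>
     N = net_spanned_by (\<lambda>x y z. x^2) (\<lambda>x y z. y^2) (\<lambda>x y z. 2*x*z + 2*y*z)"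
| "normal_form Type_Fstar N \<longleftrightarrow>
     N = net_spanned_by (\<lambda>x y z. x^2) (\<lambda>x y z. 2*x*y) (\<lambda>x y z. y^2 + z^2)"
| "normal_form Type_G N \<longleftrightarrow>
     N = net_spanned_by (\<lambda>x y z. x^2) (\<lambda>x y z. y^2) (\<lambda>x y z. 2*y*z)"
| "normal_form Type_Gstar N \<longleftrightarrow>
     N = net_spanned_by (\<lambda>x y z. x^2) (\<lambda>x y z. 2*x*y) (\<lambda>x y z. 2*y*z)"
| "normal_form Type_H N \<longleftrightarrow>
     N = net_spanned_by (\<lambda>x y z. x^2) (\<lambda>x y z. 2*x*y) (\<lambda>x y z. y^2 + 2*x*z)"

definition has_type :: "(complex^3^3) set \<Rightarrow> net_type \<Rightarrow> bool" where
  "has_type L T \<longleftrightarrow> (\<exists>N. normal_form T N \<and> congruent_nets N L)"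

end

theory Submission
  imports Defs "HOL-Computational_Algebra.Fundamental_Theorem_Algebra"
begin

text \<open>
  Choose a basis of the net and let \<open>f\<close> be the ternary cubic \<open>det\<close> in the resulting coordinates.
  Since \<open>f\<close> times the derivative of \<open>log f\<close> is the gradient of \<open>f\<close>, critical points correspond to
  vectors \<open>v\<close> with \<open>f v \<noteq> 0\<close> and \<open>\<nabla>f v = f v s\<close>, where \<open>s\<close> is a generic vector as \<open>S\<close> is generic;
  so the ML-degree is the degree of the polar map of the cubic \<open>f\<close>. For the types \<open>A\<close>, \<open>B\<close>, \<open>B\<^sup>*\<close>, \<open>C\<close>
  the cubic is in Weierstrass form and is smooth, nodal, nodal and cuspidal; elimination leaves
  a quartic in one variable, from which the singular points have to be discarded. The
  other cubics are a conic with a secant (\<open>D\<close>, \<open>D\<^sup>*\<close>) or tangent (\<open>F\<^sup>*\<close>) line, a triangle (\<open>E\<close>, \<open>E\<^sup>*\<close>),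
  and cubics in fewer than three essential variables (\<open>F\<close>, \<open>G\<close>, \<open>G\<^sup>*\<close>, \<open>H\<close>).
\<close>

section \<open>Generic symmetric matrices\<close>

lemma poly_fun_uminus [intro]: "poly_fun p \<Longrightarrow> poly_fun (\<lambda>S. - p S)"
  using poly_fun.mult[OF poly_fun.const[of "-1"]] by fastforce

lemma poly_fun_diff [intro]: "poly_fun p \<Longrightarrow> poly_fun q \<Longrightarrow> poly_fun (\<lambda>S. p S - q S)"
  using poly_fun.add[OF _ poly_fun_uminus] by fastforce

lemma poly_fun_power [intro]: "poly_fun p \<Longrightarrow> poly_fun (\<lambda>S. p S ^ n)"
  by (induction n) (auto intro: poly_fun.const poly_fun.mult)

lemma poly_fun_sum [intro]:
  "(\<And>i. i \<in> I \<Longrightarrow> poly_fun (p i)) \<Longrightarrow> poly_fun (\<lambda>S. \<Sum>i\<in>I. p i S)"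
  by (induction I rule: infinite_finite_induct) (auto intro: poly_fun.const poly_fun.add)

lemma poly_fun_trace_mult: "poly_fun (\<lambda>S. trace (S ** N))"
  unfolding trace_def matrix_matrix_mult_def
  by (simp, intro poly_fun_sum poly_fun.mult poly_fun.entry poly_fun.const)

text \<open>The entries of \<open>g ** S ** transpose g\<close> are linear in those of
  \<open>S\<close>; this transports generic conditions along a congruence.\<close>

lemma poly_fun_congruence:
  "poly_fun p \<Longrightarrow> poly_fun (\<lambda>S. p (g ** S ** transpose g))"
proof (induction rule: poly_fun.induct)
  case (entry i j)
  show ?case
    unfolding matrix_matrix_mult_def
    by (simp, intro poly_fun_sum poly_fun.mult poly_fun.entry poly_fun.const)
qed (auto intro: poly_fun.intros)

lemmas poly_fun_intros =
  poly_fun_trace_mult poly_fun.const poly_fun.add poly_fun.mult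
  poly_fun_uminus poly_fun_diff poly_fun_power

lemma for_generic_sym_mono:
  assumes "for_generic_sym P" "\<And>S. P S \<Longrightarrow> Q S"
  shows "for_generic_sym Q"
  using assms unfolding for_generic_sym_def by blast

text \<open>The product of the two polynomials works: \<open>for_generic_sym_both\<close>, applied
  to their nonvanishing, yields a symmetric matrix where neither vanishes.\<close>

lemma for_generic_sym_conj:
  assumes "for_generic_sym P" "for_generic_sym Q"
  shows "for_generic_sym (\<lambda>S. P S \<and> Q S)"
proof -
  obtain p where p: "poly_fun p" "\<exists>S\<in>sym_mats. p S \<noteq> 0" "\<And>S. S \<in> sym_mats \<Longrightarrow> p S \<noteq> 0 \<Longrightarrow> P S"
    using assms(1) unfolding for_generic_sym_def by blast
  obtain q where q: "poly_fun q" "\<exists>S\<in>sym_mats. q S \<noteq> 0" "\<And>S. S \<in> sym_mats \<Longrightarrow> q S \<noteq> 0 \<Longrightarrow> Q S"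
    using assms(2) unfolding for_generic_sym_def by blast
  have "for_generic_sym (\<lambda>S. p S \<noteq> 0)" "for_generic_sym (\<lambda>S. q S \<noteq> 0)"
    unfolding for_generic_sym_def using p q by blast+
  then obtain S where "S \<in> sym_mats" "p S \<noteq> 0" "q S \<noteq> 0"
    using for_generic_sym_both by blast
  then show ?thesis
    unfolding for_generic_sym_def
    using p q by (intro exI[of _ "\<lambda>S. p S * q S"]) (auto intro: poly_fun.mult)
qed

section \<open>Invariance under congruence\<close>

lemma trace_congruence:
  fixes S M g :: "complex^'n^'n"
  shows "trace (S ** (transpose g ** M ** g)) = trace ((g ** S ** transpose g) ** M)"
  by (metis matrix_mul_assoc trace_mul_sym)

lemma
  fixes A :: "complex^'n^'n"
  assumes "invertible A"
  shows matrix_inv_right: "A ** matrix_inv A = mat 1"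
    and matrix_inv_left: "matrix_inv A ** A = mat 1"
  using someI_ex[OF assms[unfolded invertible_def]] by (simp_all add: matrix_inv_def)

lemma matrix_inv_unique:
  fixes A B :: "complex^'n^'n"
  assumes "A ** B = mat 1"
  shows "matrix_inv A = B"
proof -
  have "invertible A"
    using assms invertible_right_inverse by blast
  then show ?thesis
    by (metis assms matrix_inv_left matrix_mul_assoc matrix_mul_lid matrix_mul_rid)
qed

text \<open>The inverse and the direction transform contragrediently, so their product is merely
  conjugated by \<open>g\<close>.\<close>

lemma trace_inv_congruence:
  fixes M N g :: "complex^'n^'n"
  assumes "invertible g" "invertible M"
  shows "trace (matrix_inv (transpose g ** M ** g) ** (transpose g ** N ** g)) =
    trace (matrix_inv M ** N)"
proof -
  let ?h = "matrix_inv g"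
  have g: "g ** ?h = mat 1" "?h ** g = mat 1"
    using assms(1) by (simp_all add: matrix_inv_left matrix_inv_right)
  have t: "transpose g ** transpose ?h = mat 1" "transpose ?h ** transpose g = mat 1"
    using g by (metis matrix_transpose_mul transpose_mat)+
  have "(transpose g ** M ** g) ** (?h ** matrix_inv M ** transpose ?h) = mat 1"
    by (metis assms(2) g(1) t(1) matrix_inv_right matrix_mul_assoc matrix_mul_rid)
  then have "matrix_inv (transpose g ** M ** g) = ?h ** matrix_inv M ** transpose ?h"
    by (rule matrix_inv_unique)
  then have "matrix_inv (transpose g ** M ** g) ** (transpose g ** N ** g)
      = ?h ** (matrix_inv M ** N ** g)"
    by (metis t(2) matrix_mul_assoc matrix_mul_rid)
  then show ?thesis
    by (metis g(1) trace_mul_sym matrix_mul_assoc matrix_mul_rid)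
qed

lemma invertible_congruence_iff:
  fixes M g :: "complex^'n^'n"
  assumes "invertible g"
  shows "invertible (transpose g ** M ** g) \<longleftrightarrow> invertible M"
  using assms by (simp add: invertible_det_nz det_mul)

lemma inj_congruence:
  fixes g :: "complex^'n^'n"
  assumes "invertible g"
  shows "inj (\<lambda>M. transpose g ** M ** g)"
proof (rule inj_on_inverseI)
  have g: "g ** matrix_inv g = mat 1"
    using assms by (simp add: matrix_inv_right)
  moreover have "transpose (matrix_inv g) ** transpose g = mat 1"
    using g by (metis matrix_transpose_mul transpose_mat)
  ultimately show "transpose (matrix_inv g) ** (transpose g ** M ** g) ** matrix_inv g = M" for M
    by (metis matrix_mul_assoc matrix_mul_lid matrix_mul_rid)
qed

text \<open>For the trace pairing, the adjoint of the action on the net is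
  \<open>g ** S ** transpose g\<close>, so the data matrix moves by this map.\<close>

lemma critical_points_congruence:
  fixes g :: "complex^'n^'n"
  assumes "invertible g"
  shows "critical_points ((\<lambda>M. transpose g ** M ** g) ` L) S =
    (\<lambda>M. transpose g ** M ** g) ` critical_points L (g ** S ** transpose g)"
  using trace_inv_congruence[OF assms]
  by (auto simp: critical_points_def trace_congruence invertible_congruence_iff[OF assms])

lemma has_ml_degree_congruence:
  fixes g :: "complex^'n^'n"
  assumes g: "invertible g" and "has_ml_degree L d"
  shows "has_ml_degree ((\<lambda>M. transpose g ** M ** g) ` L) d"
proof -
  let ?\<phi> = "\<lambda>S. g ** S ** transpose g" and ?h = "matrix_inv g"
  obtain p S0 where p: "poly_fun p" "S0 \<in> sym_mats" "p S0 \<noteq> 0"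
    "\<And>S. S \<in> sym_mats \<Longrightarrow> p S \<noteq> 0 \<Longrightarrow> finite (critical_points L S) \<and> card (critical_points L S) = d"
    using assms(2) unfolding has_ml_degree_def for_generic_sym_def by blast
  have sym: "A ** S ** transpose A \<in> sym_mats" if "S \<in> sym_mats" for A S :: "complex^'n^'n"
    using that by (simp add: sym_mats_def matrix_transpose_mul matrix_mul_assoc)
  have gh: "g ** ?h = mat 1" "transpose ?h ** transpose g = mat 1"
    using g by (simp_all add: matrix_inv_right flip: matrix_transpose_mul)
  \<comment> \<open>Pulling \<open>S0\<close> back shows that the transported polynomial is not
    identically zero on \<open>sym_mats\<close>.\<close>
  have "?\<phi> (?h ** S0 ** transpose ?h) = S0"
    by (metis gh matrix_mul_assoc matrix_mul_lid matrix_mul_rid)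
  then have "\<exists>S\<in>sym_mats. p (?\<phi> S) \<noteq> 0"
    using p(2,3) sym by metis
  moreover have "finite (critical_points L' S) \<and> card (critical_points L' S) = d"
    if "S \<in> sym_mats" "p (?\<phi> S) \<noteq> 0" "L' = (\<lambda>M. transpose g ** M ** g) ` L" for S L'
    using p(4)[OF sym[OF that(1)] that(2)] inj_congruence[OF g] that(3)
    by (simp add: critical_points_congruence[OF g] card_image inj_on_subset)
  ultimately show ?thesis
    unfolding has_ml_degree_def for_generic_sym_def
    using poly_fun_congruence[OF p(1), of g] by blast
qed

section \<open>Critical points in coordinates\<close>

text \<open>The adjugate. By Jacobi's formula, \<open>trace (adj3 M ** N)\<close> is the derivative
  of \<open>det\<close> at \<open>M\<close> along \<open>N\<close>.\<close>

definition adj3 :: "complex^3^3 \<Rightarrow> complex^3^3" where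
  "adj3 M = vector [
     vector [M$2$2 * M$3$3 - M$2$3 * M$3$2, M$1$3 * M$3$2 - M$1$2 * M$3$3, M$1$2 * M$2$3 - M$1$3 * M$2$2],
     vector [M$2$3 * M$3$1 - M$2$1 * M$3$3, M$1$1 * M$3$3 - M$1$3 * M$3$1, M$1$3 * M$2$1 - M$1$1 * M$2$3],
     vector [M$2$1 * M$3$2 - M$2$2 * M$3$1, M$1$2 * M$3$1 - M$1$1 * M$3$2, M$1$1 * M$2$2 - M$1$2 * M$2$1]]"

lemma adj3_mult_left: "adj3 M ** M = cscale (det M) (mat 1)"
  by (simp add: adj3_def cscale_def vec_eq_iff forall_3 matrix_matrix_mult_def sum_3 det_3 mat_def
      algebra_simps)

lemma trace_cscale_left: "trace (cscale c A ** B) = c * trace (A ** B)"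
  by (simp add: trace_def matrix_matrix_mult_def cscale_def sum_distrib_left algebra_simps)

lemma trace_cscale_right: "trace (A ** cscale c B) = c * trace (A ** B)"
  by (simp add: trace_def matrix_matrix_mult_def cscale_def sum_distrib_left algebra_simps)

text \<open>Clears the denominator of the critical equations: \<open>det M\<close> times the inverse
  is the adjugate.\<close>

lemma det_trace_matrix_inv:
  assumes "invertible M"
  shows "det M * trace (matrix_inv M ** N) = trace (adj3 M ** N)"
proof -
  have "cscale (det M) (mat 1) ** matrix_inv M = cscale (det M) (matrix_inv M)"
    by (simp add: vec_eq_iff cscale_def matrix_matrix_mult_def mat_def if_distrib if_distribR
        sum.delta cong: if_cong)
  then have "cscale (det M) (matrix_inv M) = adj3 M"
    by (metis adj3_mult_left assms matrix_inv_right matrix_mul_assoc matrix_mul_rid)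
  then show ?thesis
    by (metis trace_cscale_left)
qed

section \<open>Coordinates on a net and fibres of the polar map\<close>

definition lin_comb :: "complex^3^3 \<Rightarrow> complex^3^3 \<Rightarrow> complex^3^3 \<Rightarrow>
    complex \<Rightarrow> complex \<Rightarrow> complex \<Rightarrow> complex^3^3" where
  "lin_comb N1 N2 N3 a b c = cscale a N1 + cscale b N2 + cscale c N3"

lemma cspan_eq_lin_comb: "cspan {N1, N2, N3} = {lin_comb N1 N2 N3 a b c | a b c. True}"
proof -
  have "(\<exists>k. M - cscale k N1 \<in> cspan {N2, N3}) \<longleftrightarrow> (\<exists>a b c. M = lin_comb N1 N2 N3 a b c)" for M
    by (auto simp: cmat.span_breakdown_eq lin_comb_def algebra_simps)
  moreover have "cspan {N1, N2, N3} = {M. \<exists>k. M - cscale k N1 \<in> cspan {N2, N3}}"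
    by (simp only: set_eq_iff cmat.span_breakdown_eq[of _ N1 "{N2, N3}"] mem_Collect_eq simp_thms)
  ultimately show ?thesis
    by simp
qed

lemma trace_lin_comb:
  "trace (S ** lin_comb N1 N2 N3 a b c) =
    a * trace (S ** N1) + b * trace (S ** N2) + c * trace (S ** N3)"
  by (simp add: lin_comb_def matrix_add_ldistrib trace_add trace_cscale_right)

text \<open>Surjectivity of the three trace functionals on symmetric matrices. It makes coordinates
  on the net unique and lets the traces of \<open>S\<close> take any prescribed values.\<close>

definition trace_dual :: "complex^3^3 \<Rightarrow> complex^3^3 \<Rightarrow> complex^3^3 \<Rightarrow> bool" where
  "trace_dual N1 N2 N3 \<longleftrightarrow> (\<forall>x y z. \<exists>S\<in>sym_mats.
     trace (S ** N1) = x \<and> trace (S ** N2) = y \<and> trace (S ** N3) = z)"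

text \<open>The fibre of the polar map: the gradient of \<open>log f\<close> equals
  \<open>(x, y, z)\<close>, denominators cleared, with \<open>f1\<close>, \<open>f2\<close>,
  \<open>f3\<close> standing for the partial derivatives of \<open>f\<close>.\<close>

definition gradient_solutions where
  "gradient_solutions f f1 f2 f3 x y z = {(a, b, c).
     f a b c \<noteq> 0 \<and> f1 a b c = f a b c * x \<and> f2 a b c = f a b c * y \<and> f3 a b c = f a b c * (z::complex)}"

lemma for_generic_symI:
  assumes "trace_dual N1 N2 N3" "F x y z \<noteq> 0"
    and "poly_fun (\<lambda>S. F (trace (S ** N1)) (trace (S ** N2)) (trace (S ** N3)))"
  shows "for_generic_sym (\<lambda>S. F (trace (S ** N1)) (trace (S ** N2)) (trace (S ** N3)) \<noteq> 0)"
proof -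
  have "\<exists>S\<in>sym_mats. trace (S ** N1) = x \<and> trace (S ** N2) = y \<and> trace (S ** N3) = z"
    using assms(1) by (simp add: trace_dual_def)
  then obtain S where "S \<in> sym_mats" "F (trace (S ** N1)) (trace (S ** N2)) (trace (S ** N3)) \<noteq> 0"
    using assms(2) by blast
  then show ?thesis
    unfolding for_generic_sym_def using assms(3)
    by (intro exI[of _ "\<lambda>S. F (trace (S ** N1)) (trace (S ** N2)) (trace (S ** N3))"]) auto
qed

text \<open>Pairing with matrices \<open>S\<close> dual to the generators reads off the
  coefficients.\<close>

lemma inj_lin_comb:
  assumes "trace_dual N1 N2 N3"
  shows "inj (\<lambda>(a, b, c). lin_comb N1 N2 N3 a b c)"
proof -
  have "a = a' \<and> b = b' \<and> c = c'"
    if "lin_comb N1 N2 N3 a b c = lin_comb N1 N2 N3 a' b' c'" for a b c a' b' c'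
  proof -
    have "a * x + b * y + c * z = a' * x + b' * y + c' * z" for x y z
      using assms that unfolding trace_dual_def by (metis trace_lin_comb)
    from this[of 1 0 0] this[of 0 1 0] this[of 0 0 1] show ?thesis
      by simp
  qed
  then show ?thesis
    by (auto intro!: injI)
qed

text \<open>The critical equations are linear in \<open>N\<close>, so it suffices to test the
  generators; multiplying by the nonzero determinant replaces the inverse by the adjugate.\<close>

lemma critical_points_cspan:
  assumes "\<And>a b c. det (lin_comb N1 N2 N3 a b c) = f a b c"
    and "\<And>a b c. trace (adj3 (lin_comb N1 N2 N3 a b c) ** N1) = f1 a b c"
    and "\<And>a b c. trace (adj3 (lin_comb N1 N2 N3 a b c) ** N2) = f2 a b c"
    and "\<And>a b c. trace (adj3 (lin_comb N1 N2 N3 a b c) ** N3) = f3 a b c"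
  shows "critical_points (cspan {N1, N2, N3}) S = (\<lambda>(a, b, c). lin_comb N1 N2 N3 a b c) `
    gradient_solutions f f1 f2 f3 (trace (S ** N1)) (trace (S ** N2)) (trace (S ** N3))"
proof -
  let ?L = "cspan {N1, N2, N3}" and ?M = "lin_comb N1 N2 N3"
  have crit: "?M a b c \<in> critical_points ?L S \<longleftrightarrow> (a, b, c) \<in>
      gradient_solutions f f1 f2 f3 (trace (S ** N1)) (trace (S ** N2)) (trace (S ** N3))" for a b c
  proof (cases "det (?M a b c) = 0")
    case True
    then show ?thesis
      using assms(1) by (simp add: critical_points_def gradient_solutions_def invertible_det_nz)
  next
    case False
    then have inv: "invertible (?M a b c)"
      by (simp add: invertible_det_nz)
    have "(trace (matrix_inv (?M a b c) ** N) = trace (S ** N)) \<longleftrightarrow>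
        trace (adj3 (?M a b c) ** N) = det (?M a b c) * trace (S ** N)" for N
      unfolding det_trace_matrix_inv[OF inv, symmetric] using False by simp
    moreover have "(\<forall>N\<in>?L. trace (A ** N) = trace (S ** N)) \<longleftrightarrow>
        (\<forall>N\<in>{N1, N2, N3}. trace (A ** N) = trace (S ** N))" for A
    proof
      show "\<forall>N\<in>{N1, N2, N3}. trace (A ** N) = trace (S ** N)"
        if "\<forall>N\<in>?L. trace (A ** N) = trace (S ** N)"
        using that by (simp add: cmat.span_base)
    qed (auto simp: cspan_eq_lin_comb trace_lin_comb)
    moreover have "?M a b c \<in> ?L"
      unfolding cspan_eq_lin_comb by blast
    ultimately show ?thesis
      using False inv assms by (simp add: critical_points_def gradient_solutions_def)
  qed
  have "\<exists>a b c. M = ?M a b c" if "M \<in> critical_points ?L S" for M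
    using that by (auto simp: critical_points_def cspan_eq_lin_comb)
  then show ?thesis
    using crit by (intro equalityI subsetI) (force simp: image_iff, clarsimp)
qed

lemma has_ml_degree_cspanI:
  assumes "trace_dual N1 N2 N3"
    and "\<And>a b c. det (lin_comb N1 N2 N3 a b c) = f a b c"
    and "\<And>a b c. trace (adj3 (lin_comb N1 N2 N3 a b c) ** N1) = f1 a b c"
    and "\<And>a b c. trace (adj3 (lin_comb N1 N2 N3 a b c) ** N2) = f2 a b c"
    and "\<And>a b c. trace (adj3 (lin_comb N1 N2 N3 a b c) ** N3) = f3 a b c"
    and "for_generic_sym P"
    and "\<And>S. P S \<Longrightarrow>
      finite (gradient_solutions f f1 f2 f3 (trace (S ** N1)) (trace (S ** N2)) (trace (S ** N3))) \<and>
      card (gradient_solutions f f1 f2 f3 (trace (S ** N1)) (trace (S ** N2)) (trace (S ** N3))) = d"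
  shows "has_ml_degree (cspan {N1, N2, N3}) d"
  unfolding has_ml_degree_def
proof (rule for_generic_sym_mono[OF assms(6)])
  show "finite (critical_points (cspan {N1, N2, N3}) S) \<and>
      card (critical_points (cspan {N1, N2, N3}) S) = d" if "P S" for S
    using assms(7)[OF that] inj_lin_comb[OF assms(1)]
    by (simp add: critical_points_cspan[OF assms(2-5)] card_image inj_on_subset)
qed

section \<open>Simple roots\<close>

text \<open>Compare degrees in the factorisation into distinct linear factors.\<close>

lemma card_roots_rsquarefree:
  fixes p :: "complex poly"
  assumes "rsquarefree p"
  shows "card {z. poly p z = 0} = degree p"
proof -
  have "p \<noteq> 0"
    using assms by (simp add: rsquarefree_def)
  have "degree p = degree (smult (lead_coeff p) (\<Prod>z|poly p z = 0. [:-z, 1:]))"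
    by (simp only: complex_poly_decompose_rsquarefree[OF assms])
  also have "\<dots> = card {z. poly p z = 0}"
    using \<open>p \<noteq> 0\<close> by (simp add: degree_prod_sum_eq)
  finally show ?thesis ..
qed

lemma card_roots_quadratic:
  fixes a b c :: complex
  assumes "a \<noteq> 0" "b^2 - 4*a*c \<noteq> 0"
  shows "card {t. a*t^2 + b*t + c = 0} = 2"
proof -
  have "\<not> (a*t^2 + b*t + c = 0 \<and> 2*a*t + b = 0)" for t
  proof
    assume "a*t^2 + b*t + c = 0 \<and> 2*a*t + b = 0"
    then have "b^2 - 4*a*c = 0"
      by algebra
    with assms(2) show False ..
  qed
  then have "rsquarefree [:c, b, a:]"
    by (simp add: rsquarefree_roots pderiv_pCons algebra_simps power2_eq_square)
  from card_roots_rsquarefree[OF this] show ?thesis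
    using assms(1) by (simp add: algebra_simps power2_eq_square)
qed

definition cubic_disc :: "complex \<Rightarrow> complex \<Rightarrow> complex \<Rightarrow> complex \<Rightarrow> complex" where
  "cubic_disc a b c d = b^2*c^2 - 4*a*c^3 - 4*b^3*d - 27*a^2*d^2 + 18*a*b*c*d"

text \<open>The two equations express \<open>c\<close> and \<open>d\<close> through
  \<open>a\<close>, \<open>b\<close>, \<open>t\<close>; the discriminant then vanishes
  identically.\<close>

lemma cubic_disc_double_root:
  assumes "a*t^3 + b*t^2 + c*t + d = 0" "3*a*t^2 + 2*b*t + c = 0"
  shows "cubic_disc a b c d = 0"
proof -
  have c: "c = -3*a*t^2 - 2*b*t"
    using assms(2) by algebra
  moreover have "d = 2*a*t^3 + b*t^2"
    using assms(1) unfolding c by algebra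
  ultimately show ?thesis
    unfolding cubic_disc_def by algebra
qed

text \<open>The discriminant of \<open>a t\<^sup>4 + p t\<^sup>2 + r t + d\<close>, up to the factor \<open>a\<close>.\<close>

definition quartic_disc :: "complex \<Rightarrow> complex \<Rightarrow> complex \<Rightarrow> complex \<Rightarrow> complex" where
  "quartic_disc a p r d =
    16*p^4*d - 4*p^3*r^2 - 128*a*p^2*d^2 + 144*a*p*r^2*d - 27*a*r^4 + 256*a^2*d^3"

text \<open>As for the cubic, now eliminating \<open>r\<close> and \<open>d\<close>.\<close>

lemma quartic_disc_double_root:
  assumes "a*t^4 + p*t^2 + r*t + d = 0" "4*a*t^3 + 2*p*t + r = 0"
  shows "quartic_disc a p r d = 0"
proof -
  have r: "r = -4*a*t^3 - 2*p*t"
    using assms(2) by algebra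
  moreover have "d = 3*a*t^4 + p*t^2"
    using assms(1) unfolding r by algebra
  ultimately show ?thesis
    unfolding quartic_disc_def by algebra
qed

lemma card_roots_quartic:
  fixes a p r d :: complex
  assumes "a \<noteq> 0" "quartic_disc a p r d \<noteq> 0"
  shows "card {t. a*t^4 + p*t^2 + r*t + d = 0} = 4"
proof -
  have eq: "poly [:d, r, p, 0, a:] t = a*t^4 + p*t^2 + r*t + d"
    "poly (pderiv [:d, r, p, 0, a:]) t = 4*a*t^3 + 2*p*t + r" for t
    by (simp_all add: pderiv_pCons algebra_simps power2_eq_square power3_eq_cube power4_eq_xxxx)
  have "rsquarefree [:d, r, p, 0, a:]"
    unfolding rsquarefree_roots eq using quartic_disc_double_root assms(2) by blast
  from card_roots_rsquarefree[OF this, unfolded eq] show ?thesis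
    using assms(1) by simp
qed

section \<open>Polar maps of cubics\<close>

text \<open>
  Eliminating \<open>b\<close> from \<open>e b\<^sup>2 = a\<^sup>3 + p a e\<^sup>2 + q e\<^sup>3\<close> by \<open>x a + y b + z e = 0\<close> gives a binary cubic
  with this discriminant, so \<open>weierstrass_dual\<close> vanishes at the tangent lines of the curve.
\<close>

definition weierstrass_dual :: "complex \<Rightarrow> complex \<Rightarrow> complex \<Rightarrow> complex \<Rightarrow> complex \<Rightarrow> complex" where
  "weierstrass_dual p q x y z = cubic_disc (y^2) (-(x^2)) (p*y^2 - 2*x*z) (q*y^2 - z^2)"

text \<open>
  Writing \<open>t = a / e\<close>, the equations of the polar map express \<open>b / e\<close> through \<open>t\<close> and leave a
  quartic in \<open>t\<close>; its roots with \<open>3 t\<^sup>2 + p = 0\<close> belong to singular points of the curve.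
\<close>

definition weierstrass_quartic ::
    "complex \<Rightarrow> complex \<Rightarrow> complex \<Rightarrow> complex \<Rightarrow> complex \<Rightarrow> complex \<Rightarrow> complex" where
  "weierstrass_quartic p q x y z t = y^2*(3*t^2 + p)^2 + 4*x*z*(3*t^2 + p) - 4*x^2*(2*p*t + 3*q)"

abbreviation weierstrass_solutions where
  "weierstrass_solutions p q \<equiv> gradient_solutions
     (\<lambda>a b e. e*b^2 - a^3 - p*a*e^2 - q*e^3)
     (\<lambda>a b e. - 3*a^2 - p*e^2) (\<lambda>a b e. 2*e*b) (\<lambda>a b e. b^2 - 2*p*a*e - 3*q*e^2)"

text \<open>The gradient at \<open>(t, \<beta>, 1)\<close> is \<open>k\<close> times
  \<open>(x, y, z)\<close>. If the point were on the curve, the line \<open>(x, y, z)\<close> would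
  be tangent there, and \<open>weierstrass_dual\<close> would vanish.\<close>

lemma weierstrass_off_curve:
  assumes "weierstrass_dual p q x y z \<noteq> 0" "k \<noteq> 0"
    and "- (3*t^2 + p) = k*x" "2*\<beta> = k*y" "\<beta>^2 - 2*p*t - 3*q = k*z"
  shows "\<beta>^2 - t^3 - p*t - q \<noteq> 0"
proof
  assume 0: "\<beta>^2 - t^3 - p*t - q = 0"
  \<comment> \<open>Euler's relation: the gradient paired with the point is three times the
    cubic.\<close>
  have "k*(x*t + y*\<beta> + z) = 0"
    using assms(3-5) 0 by algebra
  then have line: "x*t + y*\<beta> + z = 0"
    using assms(2) by simp
  have "y^2*t^3 + (-(x^2))*t^2 + (p*y^2 - 2*x*z)*t + (q*y^2 - z^2) = 0"
    using 0 line by algebra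
  \<comment> \<open>Tangency turns the intersection point into a double root: the derivative in
    \<open>t\<close> vanishes as well.\<close>
  moreover have "3*y^2*t^2 + 2*(-(x^2))*t + (p*y^2 - 2*x*z) = 0"
    using assms(3,4) line by algebra
  ultimately show False
    using assms(1) cubic_disc_double_root unfolding weierstrass_dual_def by blast
qed

text \<open>The ratio \<open>t = a / e\<close> determines a solution: the first equation gives the
  factor \<open>k\<close> between gradient and \<open>(x, y, z)\<close>, the second gives
  \<open>b / e\<close>, the third becomes the quartic, and homogeneity fixes the scale.\<close>

lemma ex_weierstrass_solutions_eq:
  fixes p q x y z :: complex
  defines "R \<equiv> {t. 3*t^2 + p \<noteq> 0 \<and> weierstrass_quartic p q x y z t = 0}"
  assumes "x \<noteq> 0" "y \<noteq> 0" "weierstrass_dual p q x y z \<noteq> 0"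
  shows "\<exists>e \<beta>. (\<forall>t\<in>R. e t \<noteq> 0) \<and>
    weierstrass_solutions p q x y z = (\<lambda>t. (e t * t, e t * \<beta> t, e t)) ` R"
proof (intro exI conjI ballI)
  let ?\<phi> = "\<lambda>t \<beta>. \<beta>^2 - t^3 - p*t - q"
  define k where "k = (\<lambda>t. - (3*t^2 + p) / x)"
  define \<beta> where "\<beta> = (\<lambda>t. k t * y / 2)"
  \<comment> \<open>At scale \<open>e\<close> the gradient grows by \<open>e^2\<close> and the cubic
    by \<open>e^3\<close>, so \<open>e^2 * k = e^3 * ?\<phi>\<close>.\<close>
  define e where "e = (\<lambda>t. k t / ?\<phi> t (\<beta> t))"
  have root: "k t \<noteq> 0 \<and> - (3*t^2 + p) = k t * x \<and> 2 * \<beta> t = k t * y \<and>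
      \<beta> t ^ 2 - 2*p*t - 3*q = k t * z \<and> ?\<phi> t (\<beta> t) \<noteq> 0"
    if "3*t^2 + p \<noteq> 0" "weierstrass_quartic p q x y z t = 0" for t
  proof -
    have 1: "k t \<noteq> 0" "- (3*t^2 + p) = k t * x" "2 * \<beta> t = k t * y"
      using assms(2) that(1) by (simp_all add: k_def \<beta>_def add_eq_0_iff)
    \<comment> \<open>Multiplied by \<open>4*x^2\<close>, the third equation is exactly the
      quartic.\<close>
    have "4*x^2*(\<beta> t ^ 2 - 2*p*t - 3*q - k t * z) = 0"
      using 1(2,3) that(2) unfolding weierstrass_quartic_def by algebra
    then have 2: "\<beta> t ^ 2 - 2*p*t - 3*q = k t * z"
      using assms(2) by simp
    show ?thesis
      using 1 2 weierstrass_off_curve[OF assms(4) 1 2] by blast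
  qed
  then show "e t \<noteq> 0" if "t \<in> R" for t
    using that by (simp add: e_def R_def)
  show "weierstrass_solutions p q x y z = (\<lambda>t. (e t * t, e t * \<beta> t, e t)) ` R"
  proof (intro equalityI subsetI)
    fix v assume v: "v \<in> weierstrass_solutions p q x y z"
    obtain a b c where abc: "v = (a, b, c)"
      by (cases v) auto
    define f where "f = c*b^2 - a^3 - p*a*c^2 - q*c^3"
    have f: "f \<noteq> 0" "- 3*a^2 - p*c^2 = f*x" "2*c*b = f*y" "b^2 - 2*p*a*c - 3*q*c^2 = f*z"
      using v unfolding abc gradient_solutions_def f_def by simp_all
    \<comment> \<open>As \<open>y \<noteq> 0\<close>, no solution lies on the line at infinity, so
      the affine chart sees them all.\<close>
    have "c \<noteq> 0"
      using f(1,3) assms(3) by auto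
    define t u where "t = a/c" and "u = b/c"
    have ab: "a = c*t" "b = c*u"
      using \<open>c \<noteq> 0\<close> by (simp_all add: t_def u_def)
    have fc: "f = c^3 * ?\<phi> t u"
      unfolding f_def ab by algebra
    define l where "l = c * ?\<phi> t u"
    have "c^2 * (- (3*t^2 + p)) = c^2 * (l*x)" "c^2 * (2*u) = c^2 * (l*y)"
      "c^2 * (u^2 - 2*p*t - 3*q) = c^2 * (l*z)"
      using f(2-4) unfolding fc ab l_def by algebra+
    then have l: "- (3*t^2 + p) = l*x" "2*u = l*y" "u^2 - 2*p*t - 3*q = l*z"
      using \<open>c \<noteq> 0\<close> by simp_all
    have "l \<noteq> 0" "?\<phi> t u \<noteq> 0"
      using f(1) unfolding fc l_def by auto
    have "k t = l"
      using l(1) assms(2) by (simp add: k_def)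
    moreover from this have "\<beta> t = u"
      by (simp add: \<beta>_def flip: l(2))
    ultimately have "e t = c"
      using \<open>?\<phi> t u \<noteq> 0\<close> by (simp add: e_def l_def)
    have "3*t^2 + p \<noteq> 0"
      using l(1) \<open>l \<noteq> 0\<close> assms(2) by (metis minus_zero mult_eq_0_iff)
    moreover have "weierstrass_quartic p q x y z t = 0"
      using l unfolding weierstrass_quartic_def by algebra
    moreover have "v = (e t * t, e t * \<beta> t, e t)"
      unfolding abc \<open>e t = c\<close> \<open>\<beta> t = u\<close> ab ..
    ultimately show "v \<in> (\<lambda>t. (e t * t, e t * \<beta> t, e t)) ` R"
      unfolding R_def by blast
  next
    fix v assume "v \<in> (\<lambda>t. (e t * t, e t * \<beta> t, e t)) ` R"
    then obtain t where t: "3*t^2 + p \<noteq> 0" "weierstrass_quartic p q x y z t = 0"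
      and v: "v = (e t * t, e t * \<beta> t, e t)"
      unfolding R_def by blast
    define c u l where "c = e t" and "u = \<beta> t" and "l = k t"
    have r: "l \<noteq> 0" "- (3*t^2 + p) = l*x" "2*u = l*y" "u^2 - 2*p*t - 3*q = l*z" "?\<phi> t u \<noteq> 0"
      using root[OF t] unfolding c_def u_def l_def by blast+
    have cl: "l = c * ?\<phi> t u" "c \<noteq> 0"
      using r(1,5) by (simp_all add: c_def e_def u_def l_def)
    define f where "f = c^3 * ?\<phi> t u"
    have f: "c*(c*u)^2 - (c*t)^3 - p*(c*t)*c^2 - q*c^3 = f" "f = c^2*l"
      unfolding f_def cl(1) by algebra+
    have "f \<noteq> 0"
      using f(2) cl(2) r(1) by simp
    moreover have "- 3*(c*t)^2 - p*c^2 = f*x" "2*c*(c*u) = f*y" "(c*u)^2 - 2*p*(c*t)*c - 3*q*c^2 = f*z"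
      using r(2-4) unfolding f(2) by algebra+
    ultimately show "v \<in> weierstrass_solutions p q x y z"
      unfolding v gradient_solutions_def mem_Collect_eq prod.case c_def[symmetric] u_def[symmetric] f(1)
      by blast
  qed
qed

text \<open>Distinct roots give distinct solutions, since the nonzero last coordinate recovers
  \<open>t\<close>.\<close>

lemma card_weierstrass_solutions:
  fixes p q x y z :: complex
  defines "R \<equiv> {t. 3*t^2 + p \<noteq> 0 \<and> weierstrass_quartic p q x y z t = 0}"
  assumes "x \<noteq> 0" "y \<noteq> 0" "weierstrass_dual p q x y z \<noteq> 0" "card R = d" "d \<noteq> 0"
  shows "finite (weierstrass_solutions p q x y z) \<and> card (weierstrass_solutions p q x y z) = d"
proof -
  obtain e \<beta> where e: "\<forall>t\<in>R. e t \<noteq> 0"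
    and eq: "weierstrass_solutions p q x y z = (\<lambda>t. (e t * t, e t * \<beta> t, e t)) ` R"
    using ex_weierstrass_solutions_eq[OF assms(2-4)] unfolding R_def by auto
  \<comment> \<open>Infinite sets have \<open>card\<close> 0, so \<open>d \<noteq> 0\<close> yields
    finiteness.\<close>
  have "finite R"
    by (rule card_ge_0_finite) (use assms(5,6) in simp)
  moreover have "inj_on (\<lambda>t. (e t * t, e t * \<beta> t, e t)) R"
    using e by (intro inj_onI) auto
  ultimately show ?thesis
    unfolding eq using assms(5) by (simp add: card_image)
qed

text \<open>Together the two equations in \<open>t\<close> say that the gradient of the cubic
  vanishes at \<open>(t, 0, 1)\<close>.\<close>

lemma weierstrass_quartic_singular:
  assumes "x \<noteq> 0" "3*t^2 + p = 0"
  shows "weierstrass_quartic p q x y z t = 0 \<longleftrightarrow> 2*p*t + 3*q = 0"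
  using assms by (simp add: weierstrass_quartic_def)

text \<open>The arguments are the coefficients of \<open>weierstrass_quartic\<close> expanded in
  powers of \<open>t\<close>; there is no cubic term.\<close>

definition weierstrass_quartic_disc ::
    "complex \<Rightarrow> complex \<Rightarrow> complex \<Rightarrow> complex \<Rightarrow> complex \<Rightarrow> complex" where
  "weierstrass_quartic_disc p q x y z = quartic_disc (9*y^2) (6*p*y^2 + 12*x*z) (- 8*p*x^2)
     (p^2*y^2 + 4*p*x*z - 12*q*x^2)"

lemma card_roots_weierstrass_quartic:
  assumes "y \<noteq> 0" "weierstrass_quartic_disc p q x y z \<noteq> 0"
  shows "card {t. weierstrass_quartic p q x y z t = 0} = 4"
proof -
  have eq: "weierstrass_quartic p q x y z t = (9*y^2)*t^4 + (6*p*y^2 + 12*x*z)*t^2 + (- 8*p*x^2)*t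
      + (p^2*y^2 + 4*p*x*z - 12*q*x^2)" for t
    unfolding weierstrass_quartic_def by algebra
  have "9*y^2 \<noteq> 0"
    using assms(1) by simp
  then show ?thesis
    using assms(2) unfolding eq weierstrass_quartic_disc_def by (rule card_roots_quartic)
qed

text \<open>Eliminating \<open>t\<close> from the equations of a singular point gives
  \<open>4*p^3 + 27*q^2 = 0\<close>, so no root is discarded.\<close>

lemma card_weierstrass_smooth:
  assumes "4*p^3 + 27*q^2 \<noteq> 0" "x \<noteq> 0" "y \<noteq> 0" "weierstrass_quartic_disc p q x y z \<noteq> 0"
  shows "card {t. 3*t^2 + p \<noteq> 0 \<and> weierstrass_quartic p q x y z t = 0} = 4"
proof -
  have "3*t^2 + p \<noteq> 0" if "weierstrass_quartic p q x y z t = 0" for t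
  proof
    assume "3*t^2 + p = 0"
    moreover from this have "2*p*t + 3*q = 0"
      using that assms(2) weierstrass_quartic_singular by blast
    ultimately have "4*p^3 + 27*q^2 = 0"
      by algebra
    with assms(1) show False ..
  qed
  then have "{t. 3*t^2 + p \<noteq> 0 \<and> weierstrass_quartic p q x y z t = 0} =
      {t. weierstrass_quartic p q x y z t = 0}"
    by blast
  then show ?thesis
    using card_roots_weierstrass_quartic[OF assms(3,4)] by simp
qed

text \<open>Exactly one of the four distinct roots belongs to the node, the solution
  \<open>?t\<close> of \<open>2*p*t + 3*q = 0\<close>.\<close>

lemma card_weierstrass_nodal:
  assumes "4*p^3 + 27*q^2 = 0" "p \<noteq> 0" "x \<noteq> 0" "y \<noteq> 0" "weierstrass_quartic_disc p q x y z \<noteq> 0"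
  shows "card {t. 3*t^2 + p \<noteq> 0 \<and> weierstrass_quartic p q x y z t = 0} = 3"
proof -
  let ?Q = "weierstrass_quartic p q x y z" and ?t = "- 3*q/(2*p)"
  have t: "2*p*?t + 3*q = 0"
    using assms(2) by simp
  have "4*p^2*(3*?t^2 + p) = 4*p^3 + 27*q^2"
    using t by algebra
  then have node: "3*?t^2 + p = 0"
    using assms(1,2) by simp
  have "?Q ?t = 0"
    using weierstrass_quartic_singular[OF assms(3) node] t by simp
  moreover have "t = ?t" if "3*t^2 + p = 0" "?Q t = 0" for t
  proof -
    have "2*p*t + 3*q = 0"
      using weierstrass_quartic_singular[OF assms(3) that(1)] that(2) by simp
    then have "p*(t - ?t) = 0"
      using t by algebra
    then show ?thesis
      using assms(2) by (metis mult_eq_0_iff right_minus_eq)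
  qed
  ultimately have eq: "{t. 3*t^2 + p \<noteq> 0 \<and> ?Q t = 0} = {t. ?Q t = 0} - {?t}" "?t \<in> {t. ?Q t = 0}"
    using node by (blast, blast)
  show ?thesis
    unfolding eq(1) card_Diff_singleton[OF eq(2)] card_roots_weierstrass_quartic[OF assms(4,5)]
    by simp
qed

text \<open>The quartic has the factor \<open>t^2\<close> belonging to the cusp; the other factor is
  a quadratic with two distinct nonzero roots.\<close>

lemma card_weierstrass_cuspidal:
  assumes "x \<noteq> 0" "y \<noteq> 0" "z \<noteq> 0"
  shows "card {t. 3*t^2 + 0 \<noteq> 0 \<and> weierstrass_quartic 0 0 x y z t = 0} = 2"
proof -
  have "weierstrass_quartic 0 0 x y z t = 3*t^2*((3*y^2)*t^2 + 0*t + 4*x*z)" for t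
    unfolding weierstrass_quartic_def by algebra
  then have "{t. 3*t^2 + 0 \<noteq> 0 \<and> weierstrass_quartic 0 0 x y z t = 0} =
      {t. (3*y^2)*t^2 + 0*t + 4*x*z = 0}"
    using assms by auto
  then show ?thesis
    using card_roots_quadratic[of "3*y^2" 0 "4*x*z"] assms by simp
qed

text \<open>For \<open>x = 0\<close>, \<open>y = 1\<close> the restricted cubic is
  \<open>t^3 + p*t + q - z^2\<close>; choosing \<open>z^2\<close> as \<open>q\<close> or
  \<open>q + 1\<close> makes its discriminant nonzero.\<close>

lemma ex_weierstrass_dual: "\<exists>x y z. weierstrass_dual p q x y z \<noteq> 0"
proof -
  have eq: "weierstrass_dual p q 0 1 z = - 4*p^3 - 27*(q - z^2)^2" for z
    by (simp add: weierstrass_dual_def cubic_disc_def)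
  show ?thesis
  proof (cases "p = 0")
    case True
    then have "weierstrass_dual p q 0 1 (csqrt (q + 1)) \<noteq> 0"
      unfolding eq by simp
    then show ?thesis by blast
  next
    case False
    then have "weierstrass_dual p q 0 1 (csqrt q) \<noteq> 0"
      unfolding eq by simp
    then show ?thesis by blast
  qed
qed

text \<open>The witnesses make the quadratic coefficient of the quartic vanish.\<close>

lemma ex_weierstrass_quartic_disc:
  assumes "p \<noteq> 0 \<or> q \<noteq> 0"
  shows "\<exists>x y z. weierstrass_quartic_disc p q x y z \<noteq> 0"
proof -
  have eq: "weierstrass_quartic_disc p q (csqrt n) 1 (- p / (2 * csqrt n)) =
      - 20736*(p^2 + 12*q*n)^3 - 995328*p^4*n^4" if "n \<noteq> 0" for n
  proof -
    define x where "x = csqrt n"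
    have x: "x \<noteq> 0" "x^2 = n"
      using that by (simp_all add: x_def)
    then have "weierstrass_quartic_disc p q x 1 (- p / (2*x)) =
        quartic_disc 9 0 (- 8*p*n) (- (p^2) - 12*q*n)"
      by (simp add: weierstrass_quartic_disc_def power2_eq_square)
    also have "\<dots> = 20736*(- (p^2) - 12*q*n)^3 - 243*(- 8*p*n)^4"
      by (simp add: quartic_disc_def)
    also have "\<dots> = - 20736*(p^2 + 12*q*n)^3 - 995328*p^4*n^4"
      by algebra
    finally show ?thesis
      unfolding x_def .
  qed
  consider "p = 0" "q \<noteq> 0" | "p \<noteq> 0" "q = 0" | "p \<noteq> 0" "q \<noteq> 0"
    using assms by blast
  then show ?thesis
  proof cases
    case 1
    then have "weierstrass_quartic_disc p q (csqrt 1) 1 (- p / (2 * csqrt 1)) \<noteq> 0"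
      by (subst eq) simp_all
    then show ?thesis by blast
  next
    case 2
    \<comment> \<open>With \<open>q = 0\<close> and \<open>n^2 = p\<close>, both terms become
      multiples of \<open>n^12\<close> with coefficients of the same sign.\<close>
    define n where "n = csqrt p"
    have n: "n \<noteq> 0" "p = n^2"
      using 2(1) by (simp_all add: n_def)
    have "weierstrass_quartic_disc p q (csqrt n) 1 (- p / (2 * csqrt n)) =
        - 20736*(p^2 + 12*q*n)^3 - 995328*p^4*n^4"
      by (rule eq[OF n(1)])
    also have "\<dots> = - 1016064*n^12"
      unfolding 2(2) n(2) by algebra
    finally have "weierstrass_quartic_disc p q (csqrt n) 1 (- p / (2 * csqrt n)) \<noteq> 0"
      using n(1) by simp
    then show ?thesis by blast
  next
    case 3
    \<comment> \<open>This choice of \<open>n\<close> kills \<open>p^2 + 12*q*n\<close>.\<close>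
    then have "weierstrass_quartic_disc p q (csqrt (- (p^2) / (12*q))) 1
        (- p / (2 * csqrt (- (p^2) / (12*q)))) \<noteq> 0"
      by (subst eq) simp_all
    then show ?thesis by blast
  qed
qed

section \<open>Reducible cubics: conic with a line, and triangle\<close>

text \<open>Let \<open>m\<close> be the value of the conic and \<open>k = c / m\<close>. The first
  two equations are linear in \<open>m\<close>, whose value \<open>t k\<close> is fixed by
  \<open>k\<close>, and the third becomes a quadratic in \<open>k\<close>, giving two
  solutions.\<close>

lemma gradient_solutions_conic_secant:
  fixes \<kappa> x y z :: complex
  assumes "\<kappa> \<noteq> 0" "x \<noteq> 0" "y \<noteq> 0" "\<kappa>*z^2 + 12*x*y \<noteq> 0" "\<kappa>*z^2 - 4*x*y \<noteq> 0"
  defines "V \<equiv> gradient_solutions (\<lambda>a b c. c*(\<kappa>*a*b - c^2))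
    (\<lambda>a b c. \<kappa>*b*c) (\<lambda>a b c. \<kappa>*a*c) (\<lambda>a b c. \<kappa>*a*b - 3*c^2) x y z"
  shows "finite V \<and> card V = 2"
proof -
  define R where "R = {k. (3*\<kappa>)*k^2 + (\<kappa>*z)*k + - (x*y) = 0}"
  define t where "t k = \<kappa> / (x*y - \<kappa>*k^2)" for k
  have root: "k \<noteq> 0 \<and> x*y - \<kappa>*k^2 \<noteq> 0" if "k \<in> R" for k
  proof -
    have k: "3*\<kappa>*k^2 + \<kappa>*z*k - x*y = 0"
      using that by (simp add: R_def)
    then have "k \<noteq> 0"
      using assms(2,3) by auto
    moreover have "x*y - \<kappa>*k^2 \<noteq> 0"
    proof
      \<comment> \<open>Subtracting this from the quadratic forces \<open>k = - z/2\<close>, which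
        makes \<open>(x, y, z)\<close> a tangent line of the conic.\<close>
      assume 0: "x*y - \<kappa>*k^2 = 0"
      have "\<kappa>*k*(2*k + z) = 0"
        using 0 k by algebra
      then have "2*k + z = 0"
        using assms(1) \<open>k \<noteq> 0\<close> by simp
      then have "\<kappa>*z^2 - 4*x*y = 0"
        using 0 by algebra
      with assms(5) show False ..
    qed
    ultimately show ?thesis ..
  qed
  have "V = (\<lambda>k. (t k * y / \<kappa>, t k * x / \<kappa>, k * t k)) ` R"
  proof (intro equalityI subsetI)
    fix v assume v: "v \<in> V"
    obtain a b c where abc: "v = (a, b, c)"
      by (cases v) auto
    define m where "m = \<kappa>*a*b - c^2"
    have m: "c \<noteq> 0" "m \<noteq> 0" "\<kappa>*b*c = c*m*x" "\<kappa>*a*c = c*m*y" "\<kappa>*a*b - 3*c^2 = c*m*z"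
      using v unfolding abc V_def gradient_solutions_def m_def by auto
    define k where "k = c / m"
    have c: "c = k*m"
      using m(2) by (simp add: k_def)
    have "c*(\<kappa>*b - m*x) = 0" "c*(\<kappa>*a - m*y) = 0"
      using m(3,4) by algebra+
    then have ab: "\<kappa>*b = m*x" "\<kappa>*a = m*y"
      using m(1) by simp_all
    have "m*(m*(x*y - \<kappa>*k^2) - \<kappa>) = 0"
      using ab c m_def by algebra
    then have inv: "m*(x*y - \<kappa>*k^2) = \<kappa>"
      using m(2) by simp
    have "m^2*((3*\<kappa>)*k^2 + (\<kappa>*z)*k + - (x*y)) = 0"
      using ab c m(5) by algebra
    then have "k \<in> R"
      using m(2) by (simp add: R_def)
    moreover have "t k = m"
      using inv root[OF \<open>k \<in> R\<close>] by (simp add: t_def divide_eq_eq)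
    moreover have "a = m*y/\<kappa>" "b = m*x/\<kappa>"
      using ab assms(1) by (simp_all add: eq_divide_eq mult.commute)
    ultimately show "v \<in> (\<lambda>k. (t k * y / \<kappa>, t k * x / \<kappa>, k * t k)) ` R"
      unfolding abc c by blast
  next
    fix v assume "v \<in> (\<lambda>k. (t k * y / \<kappa>, t k * x / \<kappa>, k * t k)) ` R"
    then obtain k where k: "k \<in> R" and v: "v = (t k * y / \<kappa>, t k * x / \<kappa>, k * t k)"
      by blast
    define m a b where "m = t k" and "a = m*y/\<kappa>" and "b = m*x/\<kappa>"
    have ab: "\<kappa>*a = m*y" "\<kappa>*b = m*x"
      using assms(1) by (simp_all add: a_def b_def)
    have m: "m*(x*y - \<kappa>*k^2) = \<kappa>" "m \<noteq> 0" "k \<noteq> 0"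
      using root[OF k] assms(1) by (simp_all add: m_def t_def)
    have "\<kappa>*(\<kappa>*a*b - (k*m)^2 - m) = 0"
      using ab m(1) by algebra
    then have f: "\<kappa>*a*b - (k*m)^2 = m"
      using assms(1) by simp
    have "3*\<kappa>*k^2 + \<kappa>*z*k - x*y = 0"
      using k by (simp add: R_def)
    then have "\<kappa>*(\<kappa>*a*b - 3*(k*m)^2 - k*m*m*z) = 0"
      using ab by algebra
    then have "\<kappa>*a*b - 3*(k*m)^2 = k*m*m*z"
      using assms(1) by simp
    moreover have "\<kappa>*b*(k*m) = k*m*m*x" "\<kappa>*a*(k*m) = k*m*m*y" "k*m*m \<noteq> 0"
      using ab m by simp_all
    ultimately show "v \<in> V"
      unfolding v V_def gradient_solutions_def m_def[symmetric] a_def[symmetric] b_def[symmetric]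
        mem_Collect_eq prod.case f
      by blast
  qed
  moreover have "card R = 2"
    unfolding R_def
  proof (rule card_roots_quadratic)
    have "\<kappa>*(\<kappa>*z^2 + 12*x*y) \<noteq> 0"
      using assms(1,4) by simp
    then show "(\<kappa>*z)^2 - 4*(3*\<kappa>)*(- (x*y)) \<noteq> 0"
      by (simp add: algebra_simps power2_eq_square)
  qed (use assms(1) in simp)
  moreover from this have "finite R"
    by (intro card_ge_0_finite) simp
  moreover have "inj_on (\<lambda>k. (t k * y / \<kappa>, t k * x / \<kappa>, k * t k)) R"
    using root assms(1-3) by (intro inj_onI) (auto simp: t_def)
  ultimately show ?thesis
    by (simp add: card_image)
qed

text \<open>With \<open>m\<close> the value of the conic, \<open>a\<close>, \<open>b\<close>,
  \<open>c\<close> are all linear in \<open>m\<close>, and \<open>m\<close> itself satisfies a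
  linear equation, so the solution is unique.\<close>

lemma gradient_solutions_conic_tangent:
  fixes x y z :: complex
  assumes "x \<noteq> 0" "4*x*z - y^2 \<noteq> 0"
  shows "gradient_solutions (\<lambda>a b c. c*(a*c - b^2)) (\<lambda>a b c. c^2) (\<lambda>a b c. - 2*b*c)
      (\<lambda>a b c. 2*a*c - b^2) x y z =
    {((4*x*z + y^2) / (x*(4*x*z - y^2)), - 4*y / (4*x*z - y^2), 8*x / (4*x*z - y^2))}"
    (is "?V = {(?a, ?b, ?c)}")
proof (intro equalityI subsetI)
  fix v assume v: "v \<in> ?V"
  obtain a b c where abc: "v = (a, b, c)"
    by (cases v) auto
  define m D where "m = a*c - b^2" and "D = 4*x*z - y^2"
  have "D \<noteq> 0"
    using assms(2) by (simp add: D_def)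
  have m: "c \<noteq> 0" "m \<noteq> 0" "c^2 = c*m*x" "- 2*b*c = c*m*y" "2*a*c - b^2 = c*m*z"
    using v unfolding abc gradient_solutions_def m_def by auto
  have "c*(c - m*x) = 0" "c*(2*b + m*y) = 0"
    using m(3,4) by algebra+
  then have cb: "c - m*x = 0" "2*b + m*y = 0"
    using m(1) by auto
  \<comment> \<open>The third equation, with \<open>b\<close> and \<open>c\<close> eliminated, gives
    \<open>a\<close>; the definition of \<open>m\<close> then fixes \<open>m\<close>.\<close>
  have "m*(8*a*x - m*(y^2 + 4*x*z)) = 0" "m*(m*D - 8) = 0"
    using m(5) cb m_def D_def by algebra+
  then have mD: "m*D = 8" "8*a*x = m*(y^2 + 4*x*z)"
    using m(2) by simp_all
  have "8*(a*(x*D)) = (8*a*x)*D"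
    by (simp only: mult.assoc)
  also have "\<dots> = (m*D)*(y^2 + 4*x*z)"
    unfolding mD(2) by (simp only: ac_simps)
  finally have "8*(a*(x*D)) = 8*(4*x*z + y^2)"
    unfolding mD(1) by (simp only: add.commute)
  then have "a*(x*D) = 4*x*z + y^2"
    by (metis mult_left_cancel zero_neq_numeral)
  moreover have "2*(b*D) = - ((m*D)*y)" "c*D = (m*D)*x"
    using cb by algebra+
  then have "b*D = - 4*y" "c*D = 8*x"
    unfolding mD(1) by (simp_all add: mult.commute)
  ultimately have "a = (4*x*z + y^2) / (x*D)" "b = - 4*y / D" "c = 8*x / D"
    using assms(1) \<open>D \<noteq> 0\<close> by (simp_all only: eq_divide_eq mult_eq_0_iff simp_thms if_True if_False)
  then show "v \<in> {(?a, ?b, ?c)}"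
    unfolding abc D_def by simp
next
  fix v assume v: "v \<in> {(?a, ?b, ?c)}"
  define a b c m where "a = ?a" and "b = ?b" and "c = ?c" and "m = 8 / (4*x*z - y^2)"
  have m: "m*(4*x*z - y^2) = 8"
    using m_def assms(2) by (metis nonzero_eq_divide_eq)
  then have "m \<noteq> 0"
    by auto
  have abc: "8*a*x = m*(4*x*z + y^2)" "2*b = - m*y" "c = m*x"
    using assms by (simp_all add: a_def b_def c_def m_def)
  have "8*(a*c - b^2) = m*(m*(4*x*z - y^2))"
    using abc by algebra
  then have f: "a*c - b^2 = m"
    unfolding m by (metis mult.commute mult_left_cancel zero_neq_numeral)
  have "8*(2*a*c - b^2) = 8*(c*m*z)"
    using abc by algebra
  then have "2*a*c - b^2 = c*m*z"
    by (metis mult_left_cancel zero_neq_numeral)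
  moreover have "c^2 = c*m*x" "- 2*b*c = c*m*y"
    using abc(2,3) by algebra+
  moreover have "c*m \<noteq> 0"
    using abc(3) \<open>m \<noteq> 0\<close> assms(1) by simp
  moreover have "v = (a, b, c)"
    using v by (simp add: a_def b_def c_def)
  ultimately show "v \<in> ?V"
    by (simp only: gradient_solutions_def mem_Collect_eq prod.case f simp_thms)
qed

text \<open>The polar map is the standard quadratic Cremona map, which is birational.\<close>

lemma gradient_solutions_triangle:
  fixes \<kappa> x y z :: complex
  assumes "\<kappa> \<noteq> 0" "x \<noteq> 0" "y \<noteq> 0" "z \<noteq> 0"
  shows "gradient_solutions (\<lambda>a b c. \<kappa>*a*b*c) (\<lambda>a b c. \<kappa>*b*c) (\<lambda>a b c. \<kappa>*a*c) (\<lambda>a b c. \<kappa>*a*b) x y z =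
    {(1/x, 1/y, 1/z)}"
  using assms by (auto simp: gradient_solutions_def field_simps)

section \<open>The normal forms\<close>

definition sym_mat :: "complex \<Rightarrow> complex \<Rightarrow> complex \<Rightarrow> complex \<Rightarrow> complex \<Rightarrow> complex \<Rightarrow> complex^3^3" where
  "sym_mat a b c d e f = vector [vector [a, b, c], vector [b, d, e], vector [c, e, f]]"

text \<open>Each normal form only has to supply an explicit right inverse of the three
  traces.\<close>

lemma trace_dualI:
  assumes "\<And>x y z. trace (sym_mat (a x y z) (b x y z) (c x y z) (d x y z) (e x y z) (f x y z) ** N1) = x \<and>
     trace (sym_mat (a x y z) (b x y z) (c x y z) (d x y z) (e x y z) (f x y z) ** N2) = y \<and>
     trace (sym_mat (a x y z) (b x y z) (c x y z) (d x y z) (e x y z) (f x y z) ** N3) = z"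
  shows "trace_dual N1 N2 N3"
proof -
  have "sym_mat a b c d e f \<in> sym_mats" for a b c d e f
    by (simp add: sym_mat_def sym_mats_def transpose_def vec_eq_iff forall_3)
  then show ?thesis
    unfolding trace_dual_def using assms by blast
qed

lemma trace_mult_3:
  fixes A B :: "complex^3^3"
  shows "trace (A ** B) = A$1$1*B$1$1 + A$1$2*B$2$1 + A$1$3*B$3$1 + A$2$1*B$1$2 + A$2$2*B$2$2
    + A$2$3*B$3$2 + A$3$1*B$1$3 + A$3$2*B$2$3 + A$3$3*B$3$3"
  by (simp add: trace_def matrix_matrix_mult_def sum_3)

lemmas net_simps = trace_mult_3 det_3 adj3_def lin_comb_def cscale_def sym_mat_def form_mat_def axis_def
  power2_eq_square power3_eq_cube algebra_simps

section \<open>Wall's family as Weierstrass cubics\<close>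

context
  fixes c g :: complex
begin

abbreviation (input) "wall_gen1 \<equiv> form_mat (\<lambda>x y z. y^2 + 2*x*z)"
abbreviation (input) "wall_gen2 \<equiv> form_mat (\<lambda>x y z. 2*y*z)"
abbreviation (input) "wall_gen3 \<equiv> form_mat (\<lambda>x y z. - (x^2) - 2*g*y^2 + c*z^2 + 2*g*x*z)"

text \<open>
  Wall's normal form has the Weierstrass cubic as determinant, and \<open>4 p\<^sup>3 + 27 q\<^sup>2 = 4 c (c + 9 g\<^sup>2)\<^sup>2\<close>
  explains the conditions on \<open>c\<close> and \<open>g\<close> in type \<open>A\<close>.
\<close>

abbreviation (input) "wall_p \<equiv> c - 3*g^2"
abbreviation (input) "wall_q \<equiv> - (2*g^3 + 2*c*g)"

lemma trace_dual_wall: "trace_dual wall_gen1 wall_gen2 wall_gen3"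
  \<comment> \<open>The middle entry realises \<open>x\<close>, the entry of \<open>yz\<close>
    realises \<open>y\<close>, and the first entry adjusts the third trace to
    \<open>z\<close>.\<close>
  by (rule trace_dualI[of "\<lambda>x y z. - 2*g*x - z" "\<lambda>x y z. 0" "\<lambda>x y z. 0" "\<lambda>x y z. x"
      "\<lambda>x y z. y/2" "\<lambda>x y z. 0"]) (simp add: net_simps)

lemma det_wall: "det (lin_comb wall_gen1 wall_gen2 wall_gen3 a b e) = e*b^2 - a^3 - wall_p*a*e^2 - wall_q*e^3"
  by (simp add: net_simps)

lemma adj_wall1: "trace (adj3 (lin_comb wall_gen1 wall_gen2 wall_gen3 a b e) ** wall_gen1) = - 3*a^2 - wall_p*e^2"
  by (simp add: net_simps)

lemma adj_wall2: "trace (adj3 (lin_comb wall_gen1 wall_gen2 wall_gen3 a b e) ** wall_gen2) = 2*e*b"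
  by (simp add: net_simps)

lemma adj_wall3: "trace (adj3 (lin_comb wall_gen1 wall_gen2 wall_gen3 a b e) ** wall_gen3) = b^2 - 2*wall_p*a*e - 3*wall_q*e^2"
  by (simp add: net_simps)

end

text \<open>Encodes a nonzero polynomial in three variables; polynomiality is stated after
  substituting traces because \<open>poly_fun\<close> concerns functions of matrices.\<close>

definition generic_condition :: "(complex \<Rightarrow> complex \<Rightarrow> complex \<Rightarrow> complex) \<Rightarrow> bool" where
  "generic_condition F \<longleftrightarrow> (\<exists>x y z. F x y z \<noteq> 0) \<and> (\<forall>N1 N2 N3 :: complex^3^3.
     poly_fun (\<lambda>S. F (trace (S ** N1)) (trace (S ** N2)) (trace (S ** N3))))"

lemma generic_conditionI:
  assumes "F x y z \<noteq> 0"
    and "\<And>N1 N2 N3 :: complex^3^3.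
      poly_fun (\<lambda>S. F (trace (S ** N1)) (trace (S ** N2)) (trace (S ** N3)))"
  shows "generic_condition F"
  using assms unfolding generic_condition_def by blast

lemma generic_condition_coordinates:
  "generic_condition (\<lambda>x y z. x)" "generic_condition (\<lambda>x y z. y)" "generic_condition (\<lambda>x y z. z)"
  by (rule generic_conditionI[of _ 1 1 1], simp, rule poly_fun_trace_mult)+

lemma for_generic_sym_conditions:
  assumes "trace_dual N1 N2 N3" "\<And>F. F \<in> set Fs \<Longrightarrow> generic_condition F"
  shows "for_generic_sym (\<lambda>S. \<forall>F\<in>set Fs. F (trace (S ** N1)) (trace (S ** N2)) (trace (S ** N3)) \<noteq> 0)"
  using assms(2)
proof (induction Fs)
  case Nil
  have "(0 :: complex^3^3) \<in> sym_mats"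
    by (simp add: sym_mats_def transpose_def vec_eq_iff)
  then show ?case
    unfolding for_generic_sym_def by (intro exI[of _ "\<lambda>S. 1"]) (auto intro: poly_fun.const)
next
  case (Cons F Fs)
  have "generic_condition F"
    using Cons.prems by simp
  then have "for_generic_sym (\<lambda>S. F (trace (S ** N1)) (trace (S ** N2)) (trace (S ** N3)) \<noteq> 0)"
    unfolding generic_condition_def using for_generic_symI[OF assms(1)] by blast
  from for_generic_sym_conj[OF this Cons.IH] show ?case
    using Cons.prems by simp
qed

text \<open>Reduces the ML-degree to counting a polar fibre over points off finitely many
  hypersurfaces.\<close>

lemma has_ml_degree_cspan_generic:
  assumes "trace_dual N1 N2 N3"
    and "\<And>F. F \<in> set Fs \<Longrightarrow> generic_condition F"
    and "\<And>x y z. \<forall>F\<in>set Fs. F x y z \<noteq> 0 \<Longrightarrow>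
      finite (gradient_solutions f f1 f2 f3 x y z) \<and> card (gradient_solutions f f1 f2 f3 x y z) = d"
    and "\<And>a b c. det (lin_comb N1 N2 N3 a b c) = f a b c"
    and "\<And>a b c. trace (adj3 (lin_comb N1 N2 N3 a b c) ** N1) = f1 a b c"
    and "\<And>a b c. trace (adj3 (lin_comb N1 N2 N3 a b c) ** N2) = f2 a b c"
    and "\<And>a b c. trace (adj3 (lin_comb N1 N2 N3 a b c) ** N3) = f3 a b c"
  shows "has_ml_degree (cspan {N1, N2, N3}) d"
  by (rule has_ml_degree_cspanI[OF assms(1,4-7) for_generic_sym_conditions[OF assms(1), of Fs, OF assms(2)]])
    (assumption, rule assms(3))

section \<open>Types \<open>A\<close>, \<open>B\<close>, \<open>Bstar\<close> and
  \<open>C\<close>\<close>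

lemma generic_condition_weierstrass_dual: "generic_condition (weierstrass_dual p q)"
proof -
  obtain x y z where "weierstrass_dual p q x y z \<noteq> 0"
    using ex_weierstrass_dual by blast
  then show ?thesis
    by (rule generic_conditionI) (unfold weierstrass_dual_def cubic_disc_def, intro poly_fun_intros)
qed

lemma generic_condition_weierstrass_quartic_disc:
  assumes "p \<noteq> 0 \<or> q \<noteq> 0"
  shows "generic_condition (weierstrass_quartic_disc p q)"
proof -
  obtain x y z where "weierstrass_quartic_disc p q x y z \<noteq> 0"
    using ex_weierstrass_quartic_disc[OF assms] by blast
  then show ?thesis
    by (rule generic_conditionI)
      (unfold weierstrass_quartic_disc_def quartic_disc_def, intro poly_fun_intros)
qed

text \<open>Avoiding the coordinate lines and the dual curve is common to the family;
  \<open>Fs\<close> holds the further conditions of each case.\<close>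

lemma has_ml_degree_weierstrass:
  assumes "\<And>F. F \<in> set Fs \<Longrightarrow> generic_condition F" "d \<noteq> 0"
    and "\<And>x y z. x \<noteq> 0 \<Longrightarrow> y \<noteq> 0 \<Longrightarrow> z \<noteq> 0 \<Longrightarrow> \<forall>F\<in>set Fs. F x y z \<noteq> 0 \<Longrightarrow>
      card {t. 3*t^2 + wall_p c g \<noteq> 0 \<and> weierstrass_quartic (wall_p c g) (wall_q c g) x y z t = 0} = d"
  shows "has_ml_degree (net_spanned_by (\<lambda>x y z. y^2 + 2*x*z) (\<lambda>x y z. 2*y*z)
    (\<lambda>x y z. - (x^2) - 2*g*y^2 + c*z^2 + 2*g*x*z)) d"
  unfolding net_spanned_by_def
proof (rule has_ml_degree_cspan_generic[OF trace_dual_wall _ _ det_wall adj_wall1 adj_wall2 adj_wall3,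
      where Fs = "(\<lambda>x y z. x) # (\<lambda>x y z. y) # (\<lambda>x y z. z) # weierstrass_dual (wall_p c g) (wall_q c g) # Fs"])
  show "generic_condition F" if "F \<in> set ((\<lambda>x y z. x) # (\<lambda>x y z. y) # (\<lambda>x y z. z) #
      weierstrass_dual (wall_p c g) (wall_q c g) # Fs)" for F
    using that assms(1) generic_condition_coordinates generic_condition_weierstrass_dual by auto
  show "finite (weierstrass_solutions (wall_p c g) (wall_q c g) x y z) \<and>
      card (weierstrass_solutions (wall_p c g) (wall_q c g) x y z) = d"
    if "\<forall>F\<in>set ((\<lambda>x y z. x) # (\<lambda>x y z. y) # (\<lambda>x y z. z) #
      weierstrass_dual (wall_p c g) (wall_q c g) # Fs). F x y z \<noteq> 0" for x y z
    by (rule card_weierstrass_solutions) (use that assms(2,3) in simp_all)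
qed

lemma has_ml_degree_A:
  assumes "c \<noteq> 0" "c \<noteq> - (9*g^2)"
  shows "has_ml_degree (net_spanned_by (\<lambda>x y z. y^2 + 2*x*z) (\<lambda>x y z. 2*y*z)
    (\<lambda>x y z. - (x^2) - 2*g*y^2 + c*z^2 + 2*g*x*z)) 4"
proof -
  have "4*(wall_p c g)^3 + 27*(wall_q c g)^2 = 4*c*(c + 9*g^2)^2"
    by algebra
  moreover have "c + 9*g^2 \<noteq> 0"
    using assms(2) by (simp add: add_eq_0_iff2)
  ultimately have disc: "4*(wall_p c g)^3 + 27*(wall_q c g)^2 \<noteq> 0"
    using assms(1) by simp
  \<comment> \<open>This ensures that the discriminant of the quartic is not identically
    zero.\<close>
  have "wall_p c g \<noteq> 0 \<or> wall_q c g \<noteq> 0"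
  proof (rule ccontr)
    assume "\<not> (wall_p c g \<noteq> 0 \<or> wall_q c g \<noteq> 0)"
    then have "wall_p c g = 0" "wall_q c g = 0"
      by blast+
    with disc show False
      by (simp only: power_zero_numeral mult_zero_right add_0_left)
  qed
  from generic_condition_weierstrass_quartic_disc[OF this] show ?thesis
    using card_weierstrass_smooth[OF disc]
    by (intro has_ml_degree_weierstrass[where Fs = "[weierstrass_quartic_disc (wall_p c g) (wall_q c g)]"])
      (simp_all only: list.set ball_simps empty_iff insert_iff zero_neq_numeral[symmetric] not_False_eq_True simp_thms)
qed

lemma has_ml_degree_nodal:
  assumes "4*(wall_p c g)^3 + 27*(wall_q c g)^2 = 0" "wall_p c g \<noteq> 0"
  shows "has_ml_degree (net_spanned_by (\<lambda>x y z. y^2 + 2*x*z) (\<lambda>x y z. 2*y*z)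
    (\<lambda>x y z. - (x^2) - 2*g*y^2 + c*z^2 + 2*g*x*z)) 3"
proof -
  have "wall_p c g \<noteq> 0 \<or> wall_q c g \<noteq> 0"
    using assms(2) by blast
  from generic_condition_weierstrass_quartic_disc[OF this] show ?thesis
    using card_weierstrass_nodal[OF assms]
    by (intro has_ml_degree_weierstrass[where Fs = "[weierstrass_quartic_disc (wall_p c g) (wall_q c g)]"])
      (simp_all only: list.set ball_simps empty_iff insert_iff zero_neq_numeral[symmetric] not_False_eq_True simp_thms)
qed

lemma has_ml_degree_B:
  "has_ml_degree (net_spanned_by (\<lambda>x y z. y^2 + 2*x*z) (\<lambda>x y z. 2*y*z)
    (\<lambda>x y z. - (x^2) - 2*y^2 - 9*z^2 + 2*x*z)) 3"
  \<comment> \<open>Here \<open>c + 9*g^2 = 0\<close> and \<open>wall_p\<close> is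
    \<open>-12\<close>.\<close>
  using has_ml_degree_nodal[of "-9" 1] by simp

lemma has_ml_degree_Bstar:
  "has_ml_degree (net_spanned_by (\<lambda>x y z. y^2 + 2*x*z) (\<lambda>x y z. 2*y*z)
    (\<lambda>x y z. - (x^2) - 2*y^2 + 2*x*z)) 3"
  \<comment> \<open>Here \<open>c = 0\<close> and \<open>wall_p\<close> is
    \<open>-3\<close>.\<close>
  using has_ml_degree_nodal[of 0 1] by simp

lemma has_ml_degree_C:
  "has_ml_degree (net_spanned_by (\<lambda>x y z. y^2 + 2*x*z) (\<lambda>x y z. 2*y*z) (\<lambda>x y z. - (x^2))) 2"
  \<comment> \<open>Both Weierstrass coefficients vanish, so the cubic is cuspidal. The quartic then
    always has a double root at the cusp, so its discriminant is not among the conditions.\<close>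
  using has_ml_degree_weierstrass[of "[]" 2 0 0] card_weierstrass_cuspidal by simp

section \<open>Types \<open>D\<close>, \<open>Dstar\<close>, \<open>E\<close>, \<open>Estar\<close>
  and \<open>Fstar\<close>\<close>

lemma generic_condition_conic_secant:
  "generic_condition (\<lambda>x y z. \<kappa>*z^2 + 12*x*y)" "generic_condition (\<lambda>x y z. \<kappa>*z^2 - 4*x*y)"
  by (rule generic_conditionI[of _ 1 1 0], simp, intro poly_fun_intros)+

lemma has_ml_degree_conic_secant:
  assumes "trace_dual N1 N2 N3" "\<kappa> \<noteq> 0"
    and "\<And>a b c. det (lin_comb N1 N2 N3 a b c) = c*(\<kappa>*a*b - c^2)"
    and "\<And>a b c. trace (adj3 (lin_comb N1 N2 N3 a b c) ** N1) = \<kappa>*b*c"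
    and "\<And>a b c. trace (adj3 (lin_comb N1 N2 N3 a b c) ** N2) = \<kappa>*a*c"
    and "\<And>a b c. trace (adj3 (lin_comb N1 N2 N3 a b c) ** N3) = \<kappa>*a*b - 3*c^2"
  shows "has_ml_degree (cspan {N1, N2, N3}) 2"
proof (rule has_ml_degree_cspan_generic[OF assms(1) _ _ assms(3-6), where
      Fs = "[\<lambda>x y z. x, \<lambda>x y z. y, \<lambda>x y z. \<kappa>*z^2 + 12*x*y, \<lambda>x y z. \<kappa>*z^2 - 4*x*y]"])
  show "generic_condition F" if "F \<in> set [\<lambda>x y z. x, \<lambda>x y z. y, \<lambda>x y z. \<kappa>*z^2 + 12*x*y,
      \<lambda>x y z. \<kappa>*z^2 - 4*x*y]" for F
    using that generic_condition_coordinates generic_condition_conic_secant by auto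
qed (rule gradient_solutions_conic_secant; simp add: assms(2))

lemma has_ml_degree_D:
  "has_ml_degree (net_spanned_by (\<lambda>x y z. x^2) (\<lambda>x y z. y^2) (\<lambda>x y z. z^2 + 2*x*y)) 2"
  unfolding net_spanned_by_def
  by (rule has_ml_degree_conic_secant[where \<kappa> = 1],
      rule trace_dualI[of "\<lambda>x y z. x" "\<lambda>x y z. 0" "\<lambda>x y z. 0" "\<lambda>x y z. y" "\<lambda>x y z. 0" "\<lambda>x y z. z"])
    (simp_all add: net_simps)

lemma has_ml_degree_Dstar:
  "has_ml_degree (net_spanned_by (\<lambda>x y z. 2*x*z) (\<lambda>x y z. 2*y*z) (\<lambda>x y z. z^2 + 2*x*y)) 2"
  unfolding net_spanned_by_def
  by (rule has_ml_degree_conic_secant[where \<kappa> = 2],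
      rule trace_dualI[of "\<lambda>x y z. 0" "\<lambda>x y z. 0" "\<lambda>x y z. x/2" "\<lambda>x y z. 0" "\<lambda>x y z. y/2" "\<lambda>x y z. z"])
    (simp_all add: net_simps)

lemma has_ml_degree_triangle:
  assumes "trace_dual N1 N2 N3" "\<kappa> \<noteq> 0"
    and "\<And>a b c. det (lin_comb N1 N2 N3 a b c) = \<kappa>*a*b*c"
    and "\<And>a b c. trace (adj3 (lin_comb N1 N2 N3 a b c) ** N1) = \<kappa>*b*c"
    and "\<And>a b c. trace (adj3 (lin_comb N1 N2 N3 a b c) ** N2) = \<kappa>*a*c"
    and "\<And>a b c. trace (adj3 (lin_comb N1 N2 N3 a b c) ** N3) = \<kappa>*a*b"
  shows "has_ml_degree (cspan {N1, N2, N3}) 1"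
proof (rule has_ml_degree_cspan_generic[OF assms(1) _ _ assms(3-6), where
      Fs = "[\<lambda>x y z. x, \<lambda>x y z. y, \<lambda>x y z. z]"])
  show "generic_condition F" if "F \<in> set [\<lambda>x y z. x, \<lambda>x y z. y, \<lambda>x y z. z]" for F
    using that generic_condition_coordinates by auto
qed (simp add: gradient_solutions_triangle assms(2))

lemma has_ml_degree_E:
  "has_ml_degree (net_spanned_by (\<lambda>x y z. x^2) (\<lambda>x y z. y^2) (\<lambda>x y z. z^2)) 1"
  unfolding net_spanned_by_def
  by (rule has_ml_degree_triangle[where \<kappa> = 1],
      rule trace_dualI[of "\<lambda>x y z. x" "\<lambda>x y z. 0" "\<lambda>x y z. 0" "\<lambda>x y z. y" "\<lambda>x y z. 0" "\<lambda>x y z. z"])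
    (simp_all add: net_simps)

lemma has_ml_degree_Estar:
  "has_ml_degree (net_spanned_by (\<lambda>x y z. 2*x*z) (\<lambda>x y z. 2*y*z) (\<lambda>x y z. 2*x*y)) 1"
  unfolding net_spanned_by_def
  by (rule has_ml_degree_triangle[where \<kappa> = 2],
      rule trace_dualI[of "\<lambda>x y z. 0" "\<lambda>x y z. z/2" "\<lambda>x y z. x/2" "\<lambda>x y z. 0" "\<lambda>x y z. y/2" "\<lambda>x y z. 0"])
    (simp_all add: net_simps)

lemma has_ml_degree_Fstar:
  "has_ml_degree (net_spanned_by (\<lambda>x y z. x^2) (\<lambda>x y z. 2*x*y) (\<lambda>x y z. y^2 + z^2)) 1"
  unfolding net_spanned_by_def
proof (rule has_ml_degree_cspan_generic[where Fs = "[\<lambda>x y z. x, \<lambda>x y z. 4*x*z - y^2]"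
      and f = "\<lambda>a b c. c*(a*c - b^2)" and ?f1.0 = "\<lambda>a b c. c^2"
      and ?f2.0 = "\<lambda>a b c. - 2*b*c" and ?f3.0 = "\<lambda>a b c. 2*a*c - b^2"])
  show "trace_dual (form_mat (\<lambda>x y z. x^2)) (form_mat (\<lambda>x y z. 2*x*y)) (form_mat (\<lambda>x y z. y^2 + z^2))"
    by (rule trace_dualI[of "\<lambda>x y z. x" "\<lambda>x y z. y/2" "\<lambda>x y z. 0" "\<lambda>x y z. 0" "\<lambda>x y z. 0" "\<lambda>x y z. z"])
      (simp add: net_simps)
  have "generic_condition (\<lambda>x y z. 4*x*z - y^2)"
    by (rule generic_conditionI[of _ 0 1 0], simp, intro poly_fun_intros)
  then show "generic_condition F" if "F \<in> set [\<lambda>x y z. x, \<lambda>x y z. 4*x*z - y^2]" for F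
    using that generic_condition_coordinates by auto
  show "finite (gradient_solutions (\<lambda>a b c. c*(a*c - b^2)) (\<lambda>a b c. c^2) (\<lambda>a b c. - 2*b*c)
        (\<lambda>a b c. 2*a*c - b^2) x y z) \<and>
      card (gradient_solutions (\<lambda>a b c. c*(a*c - b^2)) (\<lambda>a b c. c^2) (\<lambda>a b c. - 2*b*c)
        (\<lambda>a b c. 2*a*c - b^2) x y z) = 1"
    if "\<forall>F\<in>set [\<lambda>x y z. x, \<lambda>x y z. 4*x*z - y^2]. F x y z \<noteq> 0" for x y z
    using that by (subst (1 2) gradient_solutions_conic_tangent) simp_all
qed (simp_all add: net_simps)

text \<open>The polar map of the remaining cubics is not dominant, so a generic fibre is empty.\<close>

lemma has_ml_degree_0:
  assumes "trace_dual N1 N2 N3" "generic_condition F"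
    and "\<And>x y z a b c. F x y z \<noteq> 0 \<Longrightarrow> f a b c \<noteq> 0 \<Longrightarrow> f1 a b c = f a b c * x \<Longrightarrow>
      f2 a b c = f a b c * y \<Longrightarrow> f3 a b c = f a b c * z \<Longrightarrow> False"
    and "\<And>a b c. det (lin_comb N1 N2 N3 a b c) = f a b c"
    and "\<And>a b c. trace (adj3 (lin_comb N1 N2 N3 a b c) ** N1) = f1 a b c"
    and "\<And>a b c. trace (adj3 (lin_comb N1 N2 N3 a b c) ** N2) = f2 a b c"
    and "\<And>a b c. trace (adj3 (lin_comb N1 N2 N3 a b c) ** N3) = f3 a b c"
  shows "has_ml_degree (cspan {N1, N2, N3}) 0"
proof (rule has_ml_degree_cspan_generic[OF assms(1) _ _ assms(4-7), where Fs = "[F]"])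
  show "generic_condition G" if "G \<in> set [F]" for G
    using that assms(2) by simp
  show "finite (gradient_solutions f f1 f2 f3 x y z) \<and> card (gradient_solutions f f1 f2 f3 x y z) = 0"
    if "\<forall>F\<in>set [F]. F x y z \<noteq> 0" for x y z
  proof -
    have "gradient_solutions f f1 f2 f3 x y z = {}"
      using assms(3) that by (auto simp: gradient_solutions_def)
    then show ?thesis
      by simp
  qed
qed

text \<open>The cubic depends only on \<open>a + b\<close> and \<open>c\<close>, so the polar map
  lands in the line \<open>x = y\<close>.\<close>

lemma has_ml_degree_F:
  "has_ml_degree (net_spanned_by (\<lambda>x y z. x^2) (\<lambda>x y z. y^2) (\<lambda>x y z. 2*x*z + 2*y*z)) 0"
  unfolding net_spanned_by_def
proof (rule has_ml_degree_0[where F = "\<lambda>x y z. x - y" and f = "\<lambda>a b c. - (a + b)*c^2"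
      and ?f1.0 = "\<lambda>a b c. - (c^2)" and ?f2.0 = "\<lambda>a b c. - (c^2)" and ?f3.0 = "\<lambda>a b c. - 2*(a + b)*c"])
  show "trace_dual (form_mat (\<lambda>x y z. x^2)) (form_mat (\<lambda>x y z. y^2)) (form_mat (\<lambda>x y z. 2*x*z + 2*y*z))"
    by (rule trace_dualI[of "\<lambda>x y z. x" "\<lambda>x y z. 0" "\<lambda>x y z. z/2" "\<lambda>x y z. y" "\<lambda>x y z. 0" "\<lambda>x y z. 0"])
      (simp add: net_simps)
  show "generic_condition (\<lambda>x y z. x - y)"
    by (rule generic_conditionI[of _ 1 0 0], simp, intro poly_fun_intros)
  show False
    if "x - y \<noteq> 0" "- (a + b)*c^2 \<noteq> 0" "- (c^2) = - (a + b)*c^2*x" "- (c^2) = - (a + b)*c^2*y"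
    for x y a b c :: complex
    using that by (metis mult_left_cancel right_minus_eq)
qed (simp_all add: net_simps)

text \<open>The cubic is independent of \<open>b\<close>, so the polar map lands in
  \<open>y = 0\<close>.\<close>

lemma has_ml_degree_G:
  "has_ml_degree (net_spanned_by (\<lambda>x y z. x^2) (\<lambda>x y z. y^2) (\<lambda>x y z. 2*y*z)) 0"
  unfolding net_spanned_by_def
  by (rule has_ml_degree_0[OF _ generic_condition_coordinates(2), where f = "\<lambda>a b c. - a*c^2"
        and ?f1.0 = "\<lambda>a b c. - (c^2)" and ?f2.0 = "\<lambda>a b c. 0" and ?f3.0 = "\<lambda>a b c. - 2*a*c"],
      rule trace_dualI[of "\<lambda>x y z. x" "\<lambda>x y z. 0" "\<lambda>x y z. 0" "\<lambda>x y z. y" "\<lambda>x y z. z/2" "\<lambda>x y z. 0"])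
    (simp_all add: net_simps)

lemma has_ml_degree_Gstar:
  "has_ml_degree (net_spanned_by (\<lambda>x y z. x^2) (\<lambda>x y z. 2*x*y) (\<lambda>x y z. 2*y*z)) 0"
  unfolding net_spanned_by_def
  by (rule has_ml_degree_0[OF _ generic_condition_coordinates(2), where f = "\<lambda>a b c. - a*c^2"
        and ?f1.0 = "\<lambda>a b c. - (c^2)" and ?f2.0 = "\<lambda>a b c. 0" and ?f3.0 = "\<lambda>a b c. - 2*a*c"],
      rule trace_dualI[of "\<lambda>x y z. x" "\<lambda>x y z. y/2" "\<lambda>x y z. 0" "\<lambda>x y z. 0" "\<lambda>x y z. z/2" "\<lambda>x y z. 0"])
    (simp_all add: net_simps)

text \<open>The cubic is a triple line independent of \<open>a\<close>, so the polar map lands in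
  \<open>x = 0\<close>.\<close>

lemma has_ml_degree_H:
  "has_ml_degree (net_spanned_by (\<lambda>x y z. x^2) (\<lambda>x y z. 2*x*y) (\<lambda>x y z. y^2 + 2*x*z)) 0"
  unfolding net_spanned_by_def
  by (rule has_ml_degree_0[OF _ generic_condition_coordinates(1), where f = "\<lambda>a b c. - (c^3)"
        and ?f1.0 = "\<lambda>a b c. 0" and ?f2.0 = "\<lambda>a b c. 0" and ?f3.0 = "\<lambda>a b c. - 3*c^2"],
      rule trace_dualI[of "\<lambda>x y z. x" "\<lambda>x y z. y/2" "\<lambda>x y z. 0" "\<lambda>x y z. z" "\<lambda>x y z. 0" "\<lambda>x y z. 0"])
    (simp_all add: net_simps)

theorem theorem4p7:
  fixes L :: "(complex^3^3) set" and T :: net_type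
  assumes "regular_net L" and "has_type L T"
  shows "has_ml_degree L
    (case T of
       Type_A \<Rightarrow> 4
     | Type_B \<Rightarrow> 3 | Type_Bstar \<Rightarrow> 3
     | Type_C \<Rightarrow> 2 | Type_D \<Rightarrow> 2 | Type_Dstar \<Rightarrow> 2
     | Type_E \<Rightarrow> 1 | Type_Estar \<Rightarrow> 1 | Type_Fstar \<Rightarrow> 1
     | Type_F \<Rightarrow> 0 | Type_G \<Rightarrow> 0 | Type_Gstar \<Rightarrow> 0 | Type_H \<Rightarrow> 0)"
proof -
  obtain N g where N: "normal_form T N" and g: "invertible g"
    and L: "L = (\<lambda>M. transpose g ** M ** g) ` N"
    using assms(2) unfolding has_type_def congruent_nets_def by blast
  \<comment> \<open>Congruence invariance leaves only the normal form to be treated.\<close>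
  show ?thesis
    unfolding L
    by (rule has_ml_degree_congruence[OF g], use N in \<open>cases T\<close>)
      (auto simp del: One_nat_def intro: has_ml_degree_A has_ml_degree_B has_ml_degree_Bstar has_ml_degree_C has_ml_degree_D
        has_ml_degree_Dstar has_ml_degree_E has_ml_degree_Estar has_ml_degree_F has_ml_degree_Fstar
        has_ml_degree_G has_ml_degree_Gstar has_ml_degree_H)
qed

end
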